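(* Let $\mathbb{F}_q$ be a finite field with $q$ elements, let $S=\mathbb{F}_q[t_1,\ldots,t_s]$ with the standard grading, let $v_1,\ldots,v_s\in\mathbb{N}^n$, let $X\subset\mathbb{P}^{s-1}$ be the projective algebraic toric set over $\mathbb{F}_q$ parameterized by the monomials with exponent vectors $v_1,\ldots,v_s$, and let $I(X)\subset S$ be its vanishing ideal. Then $I(X)$ is a complete intersection if and only if there are homogeneous binomials $h_1,\ldots,h_{s-1}$ in $I(X)$ such that the following conditions hold: (i) $\mathcal{L}=\langle\widehat{h}_1,\ldots,\widehat{h}_{s-1}\rangle$, where $\mathcal{L}\subset\mathbb{Z}^s$ is the lattice that defines $I(X)$; (ii) $V(h_1,\ldots,h_{s-1},t_i)=\{0\}$ for $i=1,\ldots,s$; (iii) for each $i=1,\ldots,s-1$ there is $a_i\in\mathbb{Z}^s$ such that $h_i=t^{a_i^+}-t^{a_i^-}$.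
   Context: $\mathbb{N}$ denotes the nonnegative integers and $\mathbb{F}_q^*=\mathbb{F}_q\setminus\{0\}$. Writing $v_i=(v_{i1},\ldots,v_{in})$, $X=\{[(x_1^{v_{11}}\cdots x_n^{v_{1n}},\ldots,x_1^{v_{s1}}\cdots x_n^{v_{sn}})]\mid x_i\in\mathbb{F}_q^*\text{ for all }i\}\subset\mathbb{P}^{s-1}$, where $\mathbb{P}^{s-1}$ is the projective space over $\mathbb{F}_q$. The vanishing ideal $I(X)$ is the ideal of $S$ generated by the homogeneous polynomials (standard grading, $\deg t_i=1$) that vanish on $X$. For $a=(a_1,\ldots,a_s)\in\mathbb{N}^s$, $t^a=t_1^{a_1}\cdots t_s^{a_s}$. A binomial is a polynomial $g=t^a-t^b$ with $a,b\in\mathbb{N}^s$, and $\widehat{g}=a-b$. Any $c\in\mathbb{Z}^s$ is written uniquely as $c=c^+-c^-$ with $c^+,c^-\in\mathbb{N}^s$ having disjoint supports. For a lattice (subgroup) $\mathcal{L}\subset\mathbb{Z}^s$, its lattice ideal is $I(\mathcal{L})=(\{t^{a^+}-t^{a^-}\mid a\in\mathcal{L}\})$. It is known that $I(X)$ is a lattice ideal and that there is a unique lattice $\mathcal{L}$ with $I(X)=I(\mathcal{L})$; this is the lattice that defines $I(X)$. $\langle B\rangle$ is the subgroup of $\mathbb{Z}^s$ generated by $B$. $V(I)$ is the set of $a\in\mathbb{F}_q^s$ with $f(a)=0$ for all $f\in I$. An ideal $I\subset S$ is a complete intersection if there are $g_1,\ldots,g_r\in S$ with $I=(g_1,\ldots,g_r)$,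 where $r$ is the height of $I$. *)

theory Defs
  imports
    "HOL-Library.Poly_Mapping"
    "HOL-Library.Extended_Nat"
    "HOL-Computational_Algebra.Group_Closure"
    "HOL-Analysis.Finite_Cartesian_Product"
begin

section \<open>Ideals of a commutative ring\<close>

text \<open>A commutative ring is a module over itself; its submodules (\<open>ideal.subspace\<close>) are the
  ideals, and \<open>ideal.span B\<close> is the ideal generated by \<open>B\<close>.\<close>

global_interpretation ideal: module "(*) :: 'a \<Rightarrow> 'a \<Rightarrow> 'a::comm_ring_1"
  by unfold_locales (simp_all add: algebra_simps)

definition prime_ideal :: "'a::comm_ring_1 set \<Rightarrow> bool" where
  "prime_ideal P \<longleftrightarrow>
     ideal.subspace P \<and> P \<noteq> UNIV \<and> (\<forall>x y. x * y \<in> P \<longrightarrow> x \<in> P \<or> y \<in> P)"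

definition prime_height :: "'a::comm_ring_1 set \<Rightarrow> enat" where
  "prime_height P =
     Sup {enat m | m. \<exists>C :: nat \<Rightarrow> 'a set.
       (\<forall>i\<le>m. prime_ideal (C i)) \<and> (\<forall>i<m. C i \<subset> C (Suc i)) \<and> C m = P}"

definition ideal_height :: "'a::comm_ring_1 set \<Rightarrow> enat" where
  "ideal_height I = Inf {prime_height P | P. prime_ideal P \<and> I \<subseteq> P}"

definition complete_intersection :: "'a::comm_ring_1 set \<Rightarrow> bool" where
  "complete_intersection I \<longleftrightarrow>
     (\<exists>gs :: 'a list. I = ideal.span (set gs) \<and> enat (length gs) = ideal_height I)"


section \<open>Polynomials in finitely many variables\<close>

text \<open>The monoid algebra of \<open>\<nat>\<^sup>s\<close> over \<open>'k\<close>: finitely supported maps from exponent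
  vectors to coefficients. The variables are indexed by the finite type \<open>'s\<close>, so that
  \<open>s = CARD('s)\<close>.\<close>

type_synonym ('k, 's) mpoly = "(nat ^ 's) \<Rightarrow>\<^sub>0 'k"

definition mpoly_monom :: "nat ^ 's \<Rightarrow> ('k::comm_ring_1, 's::finite) mpoly" where
  "mpoly_monom a = Poly_Mapping.single a 1"

definition indet :: "'s \<Rightarrow> ('k::comm_ring_1, 's::finite) mpoly" where
  "indet i = mpoly_monom (axis i 1)"

definition mpoly_eval :: "('k::comm_ring_1, 's::finite) mpoly \<Rightarrow> 'k ^ 's \<Rightarrow> 'k" where
  "mpoly_eval f x =
     (\<Sum>a\<in>Poly_Mapping.keys f. Poly_Mapping.lookup f a * (\<Prod>i\<in>UNIV. (x $ i) ^ (a $ i)))"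

definition homogeneous :: "('k::comm_ring_1, 's::finite) mpoly \<Rightarrow> bool" where
  "homogeneous f \<longleftrightarrow> (\<exists>d. \<forall>a\<in>Poly_Mapping.keys f. (\<Sum>i\<in>UNIV. a $ i) = d)"

definition zero_set :: "('k::comm_ring_1, 's::finite) mpoly set \<Rightarrow> ('k ^ 's) set" where
  "zero_set I = {x. \<forall>f\<in>I. mpoly_eval f x = 0}"


section \<open>Binomials and lattice ideals\<close>

definition int_vec :: "nat ^ 's \<Rightarrow> int ^ 's::finite" where
  "int_vec a = (\<chi> i. int (a $ i))"

definition pos_part :: "int ^ 's \<Rightarrow> nat ^ 's::finite" where
  "pos_part c = (\<chi> i. nat (c $ i))"

definition neg_part :: "int ^ 's \<Rightarrow> nat ^ 's::finite" where
  "neg_part c = (\<chi> i. nat (- (c $ i)))"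

lemma pos_part_minus_neg_part: "int_vec (pos_part c) - int_vec (neg_part c) = c"
  by (simp add: vec_eq_iff int_vec_def pos_part_def neg_part_def)

definition is_binomial :: "('k::comm_ring_1, 's::finite) mpoly \<Rightarrow> bool" where
  "is_binomial g \<longleftrightarrow> (\<exists>a b. g = mpoly_monom a - mpoly_monom b)"

text \<open>The exponent difference \<open>a - b\<close> of \<open>t\<^sup>a - t\<^sup>b\<close>. In characteristic 2 the polynomials
  \<open>t\<^sup>a - t\<^sup>b\<close> and \<open>t\<^sup>b - t\<^sup>a\<close> coincide, so there the difference is determined by the
  polynomial only up to sign and \<open>SOME\<close> picks one of the two; subgroups generated by such
  differences do not depend on the choice.\<close>

definition exponent_diff :: "('k::comm_ring_1, 's::finite) mpoly \<Rightarrow> int ^ 's" where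
  "exponent_diff g = (SOME c. \<exists>a b. g = mpoly_monom a - mpoly_monom b \<and> c = int_vec a - int_vec b)"

lemma binomial_exponents_unique:
  assumes "mpoly_monom a - mpoly_monom b = (mpoly_monom c - mpoly_monom d :: ('k::comm_ring_1, 's::finite) mpoly)"
  shows "int_vec c - int_vec d = int_vec a - int_vec b
       \<or> int_vec c - int_vec d = int_vec b - int_vec a"
proof -
  have "(if a = x then 1 else 0) - (if b = x then 1 else 0)
      = (if c = x then 1 else 0) - (if d = x then 1 else (0::'k))" for x
    using arg_cong[OF assms, of "\<lambda>f. Poly_Mapping.lookup f x"]
    by (simp add: mpoly_monom_def lookup_minus lookup_single when_def)
  from this[of a] this[of b] this[of c] this[of d] show ?thesis
    by (auto split: if_splits)
qed

lemma exponent_diff_mpoly_monom: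
  "exponent_diff (mpoly_monom a - mpoly_monom b :: ('k::comm_ring_1, 's::finite) mpoly)
     \<in> {int_vec a - int_vec b, int_vec b - int_vec a}"
  unfolding exponent_diff_def
  by (rule someI2_ex) (use binomial_exponents_unique in \<open>blast+\<close>)

definition lattice_subgroup :: "(int ^ 's::finite) set \<Rightarrow> bool" where
  "lattice_subgroup L \<longleftrightarrow> 0 \<in> L \<and> (\<forall>a\<in>L. \<forall>b\<in>L. a - b \<in> L)"

definition lattice_ideal :: "(int ^ 's) set \<Rightarrow> ('k::comm_ring_1, 's::finite) mpoly set" where
  "lattice_ideal L = ideal.span {mpoly_monom (pos_part a) - mpoly_monom (neg_part a) | a. a \<in> L}"

definition defining_lattice :: "('k::comm_ring_1, 's::finite) mpoly set \<Rightarrow> (int ^ 's) set" where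
  "defining_lattice I = (THE L. lattice_subgroup L \<and> I = lattice_ideal L)"


section \<open>Projective toric sets and vanishing ideals\<close>

text \<open>Points of projective space are the classes of nonzero vectors modulo nonzero scalars.\<close>

definition proj_rel :: "(('k::field ^ 's::finite) \<times> ('k ^ 's)) set" where
  "proj_rel = {(x, y). x \<noteq> 0 \<and> y \<noteq> 0 \<and> (\<exists>c. c \<noteq> 0 \<and> y = c *s x)}"

definition proj_space :: "('k::field ^ 's::finite) set set" where
  "proj_space = (UNIV - {0}) // proj_rel"

definition proj_point :: "'k::field ^ 's::finite \<Rightarrow> ('k ^ 's) set" where
  "proj_point x = proj_rel `` {x}"

definition toric_set :: "nat ^ 'n ^ 's \<Rightarrow> ('k::field ^ 's::finite) set set" where
  "toric_set v =
     {proj_point (\<chi> j. \<Prod>i\<in>UNIV. (x $ i) ^ (v $ j $ i)) | x :: 'k ^ 'n::finite. \<forall>i. x $ i \<noteq> 0}"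

lemma equiv_proj_rel: "equiv (UNIV - {0}) (proj_rel :: (('k::field ^ 's::finite) \<times> ('k ^ 's)) set)"
proof (rule equivI)
  show "proj_rel \<subseteq> (UNIV - {0 :: 'k ^ 's}) \<times> (UNIV - {0})"
    by (auto simp: proj_rel_def)
  show "refl_on (UNIV - {0}) (proj_rel :: (('k ^ 's) \<times> ('k ^ 's)) set)"
    by (auto simp: refl_on_def proj_rel_def vec_eq_iff intro!: exI[of _ 1])
  show "sym (proj_rel :: (('k ^ 's) \<times> ('k ^ 's)) set)"
  proof (rule symI)
    fix x y :: "'k ^ 's"
    assume "(x, y) \<in> proj_rel"
    then obtain c where "x \<noteq> 0" "y \<noteq> 0" "c \<noteq> 0" "y = c *s x"
      by (auto simp: proj_rel_def)
    then have "x = inverse c *s y"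
      by (simp add: vec_eq_iff)
    then show "(y, x) \<in> proj_rel"
      using \<open>x \<noteq> 0\<close> \<open>y \<noteq> 0\<close> \<open>c \<noteq> 0\<close> unfolding proj_rel_def
      by (auto intro!: exI[of _ "inverse c"])
  qed
  show "trans (proj_rel :: (('k ^ 's) \<times> ('k ^ 's)) set)"
  proof (rule transI)
    fix x y z :: "'k ^ 's"
    assume "(x, y) \<in> proj_rel" "(y, z) \<in> proj_rel"
    then obtain c d where cd: "x \<noteq> 0" "z \<noteq> 0" "c \<noteq> 0" "d \<noteq> 0" "y = c *s x" "z = d *s y"
      by (auto simp: proj_rel_def)
    then have "z = (d * c) *s x"
      by (simp add: vec_eq_iff)
    with cd have "\<exists>e. e \<noteq> 0 \<and> z = e *s x"
      by (metis mult_eq_0_iff)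
    with cd(1,2) show "(x, z) \<in> proj_rel"
      by (simp add: proj_rel_def)
  qed
qed

lemma toric_set_subset_proj_space: "toric_set v \<subseteq> proj_space"
  by (auto simp: toric_set_def proj_space_def proj_point_def vec_eq_iff intro!: quotientI)

text \<open>Evaluation of a homogeneous polynomial at a projective point is defined up to a nonzero
  scalar, so its vanishing may be tested on all representatives.\<close>

definition vanishing_ideal ::
  "('k::field ^ 's) set set \<Rightarrow> ('k, 's::finite) mpoly set" where
  "vanishing_ideal X =
     ideal.span {f. homogeneous f \<and> (\<forall>p\<in>X. \<forall>x\<in>p. mpoly_eval f x = 0)}"

end

theory Submission
  imports Defs "HOL-Computational_Algebra.Polynomial"
begin

text \<open>The points of the torus that parametrize \<open>X\<close> form a group \<open>Y\<close>, on which monomials are characters.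
  By the independence of characters a homogeneous polynomial that vanishes on \<open>Y\<close> is a combination
  of differences \<open>t\<^sup>a - t\<^sup>b\<close> of monomials of equal degree that agree on \<open>Y\<close>. Thus \<open>I(X)\<close> is the lattice
  ideal of the lattice \<open>L\<close> of all these \<open>a - b\<close> (\<open>span_homogeneous_vanishing\<close>), and \<open>L\<close> is determined by
  its ideal, because the sums of the coefficients of a polynomial over the cosets of \<open>L\<close> vanish on
  the ideal (\<open>binomial_in_lattice_ideal_iff\<close>).

  The height of \<open>I(X)\<close> is \<open>s - 1\<close> (\<open>toric_ideal_height\<close>). Over a finite field, \<open>I(X)\<close> contains the product
  over \<open>c \<noteq> 0\<close> of the linear forms \<open>t\<^sub>i - c t\<^sub>j\<close>, so a prime that contains \<open>I(X)\<close> contains the ideal of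
  a line through the origin. On the other hand the ideal of the line spanned by \<open>(1, \<dots>, 1)\<close>
  contains \<open>I(X)\<close>, and it is strictly below the irrelevant ideal. What remains is that a chain of
  primes in \<open>s\<close> variables has at most \<open>s\<close> strict inclusions (\<open>prime_chain_length\<close>); elements
  \<open>h\<^sub>i\<close> witnessing the inclusions are algebraically independent, and there are too few
  polynomials of bounded degree in \<open>s\<close> variables to accommodate more than \<open>s\<close> such elements.

  If \<open>I(X)\<close> is a complete intersection, it is generated by \<open>s - 1\<close> elements. Since it is also generated
  by the homogeneous binomials \<open>t\<^sup>a\<^sup>+ - t\<^sup>a\<^sup>-\<close> with \<open>a \<in> L\<close>, the graded form of Nakayama's lemma selects
  at most \<open>s - 1\<close> generators among them (\<open>few_homogeneous_generators\<close>); their differences generate \<open>L\<close>, and the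
  products of linear forms show that \<open>V(I(X), t\<^sub>j) = {0}\<close>.

  Conversely, let \<open>J\<close> be the ideal generated by \<open>s - 1\<close> binomials \<open>t\<^sup>a\<^sup>+ - t\<^sup>a\<^sup>-\<close> of \<open>I(X)\<close> that satisfy the
  conditions on the lattice and on the zero sets. One has to show \<open>t\<^sup>x - t\<^sup>y \<in> J\<close> whenever
  \<open>x - y \<in> L\<close>. The condition on the zero sets, applied to vectors with entries 0 and 1, implies
  that for each proper nonempty set \<open>C\<close> of variables some binomial has exactly one of its two
  monomials in the variables of \<open>C\<close>. A counting argument then arranges the binomials in a binary
  tree: each of them glues two disjoint blocks of variables, with one of its monomials in each
  block. Along such a tree, \<open>x\<close> can be transformed into \<open>y\<close> block by block
  (\<open>saturated_group_closure\<close>).\<close>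

text \<open>As a rewrite rule, the action law of the module \<open>'a\<close> over itself is associativity from right
  to left; it does not terminate together with \<open>mult.assoc\<close>.\<close>

declare ideal.scale_scale [simp del]

section \<open>Linear maps on polynomials determined by their values on monomials\<close>

abbreviation total_degree :: "nat ^ 's \<Rightarrow> nat" where
  "total_degree a \<equiv> \<Sum>i\<in>UNIV. a $ i"

lemma mpoly_expand:
  fixes f :: "('k::comm_ring_1, 's::finite) mpoly"
  shows "f = (\<Sum>a\<in>Poly_Mapping.keys f. Poly_Mapping.single a (Poly_Mapping.lookup f a))"
  by (rule poly_mapping_eqI)
    (simp add: lookup_sum lookup_single when_def in_keys_iff)

lemma mpoly_induct [case_names single add]:
  fixes f :: "('k::comm_ring_1, 's::finite) mpoly"
  assumes single: "\<And>a c. P (Poly_Mapping.single a c)"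
    and add: "\<And>f g. P f \<Longrightarrow> P g \<Longrightarrow> P (f + g)"
  shows "P f"
proof -
  have "P (\<Sum>a\<in>A. Poly_Mapping.single a (Poly_Mapping.lookup f a))" if "finite A" for A
    using that
  proof (induction A)
    case empty
    show ?case using single[of 0 0] by simp
  next
    case (insert a A)
    then show ?case using add[OF single] by simp
  qed
  from this[OF finite_keys[of f]] show ?thesis
    by (simp only: mpoly_expand[symmetric])
qed

text \<open>Evaluation at a point, substitution of polynomials for variables, extraction of a graded
  component and summation of the coefficients over a set of exponents are all of the following
  form; they differ in the target ring and in the values \<open>w a\<close> on the monomials.\<close>

definition extend :: "('k \<Rightarrow> 'r) \<Rightarrow> (nat ^ 's \<Rightarrow> 'r) \<Rightarrow> ('k::comm_ring_1, 's::finite) mpoly \<Rightarrow> 'r::comm_ring_1"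
  where "extend \<iota> w f = (\<Sum>a\<in>Poly_Mapping.keys f. \<iota> (Poly_Mapping.lookup f a) * w a)"

locale coefficient_hom =
  fixes \<iota> :: "'k::comm_ring_1 \<Rightarrow> 'r::comm_ring_1"
  assumes hom_add: "\<iota> (x + y) = \<iota> x + \<iota> y"
    and hom_mult: "\<iota> (x * y) = \<iota> x * \<iota> y"
    and hom_zero: "\<iota> 0 = 0"
    and hom_one: "\<iota> 1 = 1"
begin

lemma extend_eq_sum:
  assumes "finite A" "Poly_Mapping.keys f \<subseteq> A"
  shows "extend \<iota> w f = (\<Sum>a\<in>A. \<iota> (Poly_Mapping.lookup f a) * w a)"
  unfolding extend_def using assms
  by (intro sum.mono_neutral_left) (simp_all add: in_keys_iff hom_zero)

lemma extend_add: "extend \<iota> w (f + g) = extend \<iota> w f + extend \<iota> w g"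
proof -
  let ?A = "Poly_Mapping.keys f \<union> Poly_Mapping.keys g"
  have "Poly_Mapping.keys (f + g) \<subseteq> ?A"
    by (rule keys_add)
  then show ?thesis
    by (simp add: extend_eq_sum[of ?A] lookup_add hom_add distrib_right sum.distrib)
qed

lemma extend_single [simp]: "extend \<iota> w (Poly_Mapping.single a c) = \<iota> c * w a"
  by (subst extend_eq_sum[of "{a}"]) auto

lemma extend_zero [simp]: "extend \<iota> w 0 = 0"
  by (simp add: extend_def)

lemma extend_diff: "extend \<iota> w (f - g) = extend \<iota> w f - extend \<iota> w g"
  using extend_add[of w "f - g" g] by simp

lemma extend_sum: "extend \<iota> w (sum F A) = (\<Sum>x\<in>A. extend \<iota> w (F x))"
  by (induction A rule: infinite_finite_induct) (auto simp: extend_add)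

lemma extend_monom [simp]: "extend \<iota> w (mpoly_monom a) = w a"
  by (simp add: mpoly_monom_def hom_one)

lemma extend_mult:
  assumes w: "\<And>a b. w (a + b) = w a * w b"
  shows "extend \<iota> w (f * g) = extend \<iota> w f * extend \<iota> w g"
proof (induction f rule: mpoly_induct)
  case (single a c)
  show ?case
  proof (induction g rule: mpoly_induct)
    case (single b d)
    show ?case
      by (simp only: mult_single extend_single w hom_mult mult.assoc mult.left_commute)
  next
    case (add g h)
    then show ?case by (simp add: extend_add distrib_left)
  qed
qed (simp add: extend_add distrib_right)

end

interpretation scalar: coefficient_hom "\<lambda>c :: 'k::comm_ring_1. c"
  by unfold_locales auto

interpretation constant_poly: coefficient_hom "Poly_Mapping.single 0 :: 'k::comm_ring_1 \<Rightarrow> ('k, 's::finite) mpoly"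
  by unfold_locales (auto simp: single_add mult_single)

lemma monom_mult: "mpoly_monom a * mpoly_monom b = (mpoly_monom (a + b) :: ('k::comm_ring_1, 's::finite) mpoly)"
  by (simp add: mpoly_monom_def mult_single)

lemma monom_zero [simp]: "mpoly_monom 0 = 1"
  by (simp add: mpoly_monom_def)

lemma single_eq_scaled_monom:
  "Poly_Mapping.single a c = Poly_Mapping.single 0 c * (mpoly_monom a :: ('k::comm_ring_1, 's::finite) mpoly)"
  by (simp add: mpoly_monom_def mult_single)

definition vec_power :: "'r::comm_ring_1 ^ 's \<Rightarrow> nat ^ 's::finite \<Rightarrow> 'r" where
  "vec_power x a = (\<Prod>i\<in>UNIV. (x $ i) ^ (a $ i))"

lemma vec_power_add: "vec_power x (a + b) = vec_power x a * vec_power x b"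
  by (simp add: vec_power_def power_add prod.distrib)

lemma vec_power_zero [simp]: "vec_power x 0 = 1"
  by (simp add: vec_power_def)

lemma vec_power_axis [simp]: "vec_power x (axis i 1) = x $ i"
proof -
  have "vec_power x (axis i 1) = (\<Prod>j\<in>UNIV. if i = j then x $ j else 1)"
    unfolding vec_power_def by (rule prod.cong) (auto simp: axis_def)
  then show ?thesis by simp
qed

lemma mpoly_eval_extend: "mpoly_eval f x = extend (\<lambda>c. c) (vec_power x) f"
  by (simp add: mpoly_eval_def extend_def vec_power_def)

lemma mpoly_eval_mult: "mpoly_eval (f * g) x = mpoly_eval f x * mpoly_eval g x"
  by (simp add: mpoly_eval_extend scalar.extend_mult vec_power_add)

lemma mpoly_eval_add: "mpoly_eval (f + g) x = mpoly_eval f x + mpoly_eval g x"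
  by (simp add: mpoly_eval_extend scalar.extend_add)

lemma mpoly_eval_diff: "mpoly_eval (f - g) x = mpoly_eval f x - mpoly_eval g x"
  by (simp add: mpoly_eval_extend scalar.extend_diff)

lemma mpoly_eval_zero [simp]: "mpoly_eval 0 x = 0"
  by (simp add: mpoly_eval_extend)

lemma mpoly_eval_monom [simp]: "mpoly_eval (mpoly_monom a) x = vec_power x a"
  by (simp add: mpoly_eval_extend)

lemma mpoly_eval_constant [simp]: "mpoly_eval (Poly_Mapping.single 0 c) x = c"
  by (simp add: mpoly_eval_extend)

lemma mpoly_eval_indet [simp]: "mpoly_eval (indet i) x = x $ i"
  unfolding indet_def mpoly_eval_monom by (rule vec_power_axis)

lemma mpoly_eval_one [simp]: "mpoly_eval 1 x = 1"
  using mpoly_eval_monom[of 0 x] by simp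

lemma mpoly_eval_prod: "mpoly_eval (prod f A) x = (\<Prod>a\<in>A. mpoly_eval (f a) x)"
  by (induction A rule: infinite_finite_induct) (simp_all add: mpoly_eval_mult)

lemma ideal_subspace_eval_zero: "ideal.subspace {f. mpoly_eval f x = 0}"
  by (auto simp: ideal.subspace_def mpoly_eval_add mpoly_eval_mult)

lemma zero_set_span: "zero_set (ideal.span B) = zero_set B"
  unfolding zero_set_def
  using ideal.span_minimal[OF _ ideal_subspace_eval_zero, of B] ideal.span_superset[of B] by blast


section \<open>The polynomial ring is an integral domain\<close>

text \<open>Giving the variables suitable integer weights makes the finitely many exponents that occur
  pairwise distinguishable: weights \<open>N ^ 0, N ^ 1, \<dots>\<close> fail only if \<open>N\<close> is a root of one of
  finitely many nonzero integer polynomials.\<close>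

lemma exists_separating_weights:
  fixes F :: "(nat ^ 's::finite) set"
  assumes "finite F"
  shows "\<exists>w :: 's \<Rightarrow> nat. inj_on (\<lambda>a. \<Sum>i\<in>UNIV. w i * a $ i) F"
proof -
  obtain idx :: "'s \<Rightarrow> nat" where idx: "inj idx"
    using finite_imp_inj_to_nat_seg[of "UNIV :: 's set"] by (metis finite)
  define p :: "nat ^ 's \<Rightarrow> int poly" where "p = (\<lambda>a. \<Sum>i\<in>UNIV. monom (int (a $ i)) (idx i))"
  have coeff_p: "coeff (p a) (idx j) = int (a $ j)" for a j
    using idx by (simp add: p_def coeff_sum inj_eq)
  define R where "R = (\<Union>a\<in>F. \<Union>b\<in>F - {a}. {x. poly (p a - p b) x = 0})"
  have "finite {x. poly (p a - p b) x = 0}" if neq: "b \<noteq> a" for a b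
  proof (rule poly_roots_finite)
    obtain j where j: "a $ j \<noteq> b $ j"
      using neq[symmetric] unfolding vec_eq_iff by auto
    have "coeff (p a - p b) (idx j) \<noteq> 0"
      using j by (simp add: coeff_p)
    then show "p a - p b \<noteq> 0"
      by auto
  qed
  then have "finite R"
    using assms unfolding R_def by auto
  then have "finite (int -` R)"
    by (simp add: finite_vimageI)
  then obtain N where N: "int N \<notin> R"
    using ex_new_if_finite[of "int -` R"] by auto
  have eval: "poly (p a) (int N) = int (\<Sum>i\<in>UNIV. N ^ idx i * a $ i)" for a
    by (simp add: p_def poly_sum poly_monom mult.commute)
  have "inj_on (\<lambda>a. \<Sum>i\<in>UNIV. N ^ idx i * a $ i) F"
  proof (rule inj_onI, rule ccontr)
    fix a b assume "a \<in> F" "b \<in> F" and eq: "(\<Sum>i\<in>UNIV. N ^ idx i * a $ i) = (\<Sum>i\<in>UNIV. N ^ idx i * b $ i)"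
      and "a \<noteq> b"
    then have "int N \<in> R"
      unfolding R_def by (auto simp: eval simp del: of_nat_sum)
    then show False using N by contradiction
  qed
  then show ?thesis by (rule exI[of _ "\<lambda>i. N ^ idx i"])
qed

text \<open>Substituting \<open>t\<^sub>i = x ^ w i\<close> for separating weights \<open>w\<close> sends two nonzero polynomials to
  nonzero univariate polynomials.\<close>

lemma mpoly_no_zero_divisors:
  fixes f g :: "('k::idom, 's::finite) mpoly"
  assumes "f * g = 0"
  shows "f = 0 \<or> g = 0"
proof -
  interpret univ: coefficient_hom "\<lambda>c :: 'k. [:c:]"
    by unfold_locales auto
  obtain w :: "'s \<Rightarrow> nat" where w: "inj_on (\<lambda>a. \<Sum>i\<in>UNIV. w i * a $ i) (Poly_Mapping.keys f \<union> Poly_Mapping.keys g)"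
    using exists_separating_weights[of "Poly_Mapping.keys f \<union> Poly_Mapping.keys g"] by auto
  define \<phi> where "\<phi> = (\<lambda>a :: nat ^ 's. \<Sum>i\<in>UNIV. w i * a $ i)"
  define K where "K = extend (\<lambda>c. [:c:]) (\<lambda>a. monom (1 :: 'k) (\<phi> a))"
  have "\<phi> (a + b) = \<phi> a + \<phi> b" for a b
    by (simp add: \<phi>_def sum.distrib algebra_simps)
  then have "K (f * g) = K f * K g"
    unfolding K_def by (intro univ.extend_mult) (simp add: mult_monom)
  moreover have "K h \<noteq> 0" if h: "h \<in> {f, g}" "h \<noteq> 0" for h
  proof -
    from h(2) obtain a where a: "a \<in> Poly_Mapping.keys h"
      by (metis keys_eq_empty all_not_in_conv)
    have inj: "inj_on \<phi> (Poly_Mapping.keys h)"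
      using h(1) w unfolding \<phi>_def by (auto intro: inj_on_subset)
    have "coeff (K h) (\<phi> a)
        = (\<Sum>b\<in>Poly_Mapping.keys h. if b = a then Poly_Mapping.lookup h b else 0)"
      unfolding K_def extend_def coeff_sum
      by (rule sum.cong) (use a inj in \<open>auto simp: inj_on_eq_iff\<close>)
    also have "\<dots> = Poly_Mapping.lookup h a"
      using a by simp
    finally show ?thesis
      using a by (auto simp: in_keys_iff)
  qed
  moreover have "K 0 = 0" by (simp add: K_def)
  ultimately show ?thesis
    using assms by (metis insertI1 insertI2 mult_eq_0_iff)
qed


section \<open>Chains of prime ideals\<close>

definition exponents_bounded :: "nat \<Rightarrow> ('k::comm_ring_1, 's::finite) mpoly \<Rightarrow> bool" where
  "exponents_bounded N f \<longleftrightarrow> (\<forall>a\<in>Poly_Mapping.keys f. \<forall>i. a $ i \<le> N)"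

lemma exponents_bounded_exists: "\<exists>N. exponents_bounded N f"
proof
  let ?A = "(\<lambda>(a, i). a $ i) ` (Poly_Mapping.keys f \<times> UNIV)"
  show "exponents_bounded (Max ?A) f"
    unfolding exponents_bounded_def by (intro ballI allI Max_ge) auto
qed

lemma exponents_bounded_mono: "exponents_bounded M f \<Longrightarrow> M \<le> N \<Longrightarrow> exponents_bounded N f"
  unfolding exponents_bounded_def by (meson order_trans)

lemma exponents_bounded_add:
  "exponents_bounded N f \<Longrightarrow> exponents_bounded N g \<Longrightarrow> exponents_bounded N (f + g)"
  unfolding exponents_bounded_def using keys_add[of f g] by blast

lemma exponents_bounded_mult:
  assumes "exponents_bounded M f" "exponents_bounded N g"
  shows "exponents_bounded (M + N) (f * g)"
  unfolding exponents_bounded_def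
proof (intro ballI allI)
  fix a i assume "a \<in> Poly_Mapping.keys (f * g)"
  then obtain b c where "b \<in> Poly_Mapping.keys f" "c \<in> Poly_Mapping.keys g" "a = b + c"
    using keys_mult[of f g] by blast
  then show "a $ i \<le> M + N"
    using assms by (simp add: exponents_bounded_def add_mono)
qed

lemma exponents_box:
  "finite {a :: nat ^ 's::finite. \<forall>i. a $ i \<le> N}"
  "card {a :: nat ^ 's. \<forall>i. a $ i \<le> N} \<le> (N + 1) ^ CARD('s)"
proof -
  let ?B = "{a :: nat ^ 's. \<forall>i. a $ i \<le> N}" and ?T = "PiE (UNIV :: 's set) (\<lambda>_. {..N})"
  have inj: "inj_on vec_nth ?B"
    by (auto intro!: inj_onI simp: vec_nth_inject)
  have into: "vec_nth ` ?B \<subseteq> ?T"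
    by auto
  have T: "finite ?T" "card ?T = (N + 1) ^ CARD('s)"
    by (simp_all add: finite_PiE card_PiE)
  show "finite ?B"
    using inj into T(1) by (meson finite_imageD finite_subset)
  show "card ?B \<le> (N + 1) ^ CARD('s)"
    using card_inj_on_le[OF inj into T(1)] T(2) by simp
qed

lemma bounded_polynomials:
  "finite {f :: ('k::{field, finite}, 's::finite) mpoly. exponents_bounded N f}"
  "card {f :: ('k, 's) mpoly. exponents_bounded N f} \<le> CARD('k) ^ ((N + 1) ^ CARD('s))"
proof -
  let ?P = "{f :: ('k, 's) mpoly. exponents_bounded N f}"
  let ?B = "{a :: nat ^ 's. \<forall>i. a $ i \<le> N}"
  let ?T = "PiE ?B (\<lambda>_. UNIV :: 'k set)"
  let ?r = "\<lambda>f :: ('k, 's) mpoly. restrict (Poly_Mapping.lookup f) ?B"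
  have inj: "inj_on ?r ?P"
  proof (rule inj_onI)
    fix f g assume fg: "f \<in> ?P" "g \<in> ?P" "?r f = ?r g"
    show "f = g"
    proof (rule poly_mapping_eqI)
      fix a
      show "Poly_Mapping.lookup f a = Poly_Mapping.lookup g a"
      proof (cases "a \<in> ?B")
        case True
        then show ?thesis using fun_cong[OF fg(3), of a] by simp
      next
        case False
        then have "a \<notin> Poly_Mapping.keys f" "a \<notin> Poly_Mapping.keys g"
          using fg(1,2) unfolding exponents_bounded_def by auto
        then show ?thesis by (simp add: in_keys_iff)
      qed
    qed
  qed
  have into: "?r ` ?P \<subseteq> ?T"
    by (intro image_subsetI) (simp add: restrict_PiE_iff)
  have T: "finite ?T" "card ?T = CARD('k) ^ card ?B"
    using exponents_box(1)[where ?'s = 's, of N] by (simp_all add: finite_PiE card_PiE)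
  show "finite ?P"
    using inj into T(1) by (meson finite_imageD finite_subset)
  have "card ?P \<le> CARD('k) ^ card ?B"
    using card_inj_on_le[OF inj into T(1)] T(2) by simp
  also have "\<dots> \<le> CARD('k) ^ ((N + 1) ^ CARD('s))"
    by (rule power_increasing[OF exponents_box(2)]) simp
  finally show "card ?P \<le> \<dots>" .
qed

definition incongruent :: "'a::comm_ring_1 set \<Rightarrow> 'a set \<Rightarrow> bool" where
  "incongruent P F \<longleftrightarrow> (\<forall>f\<in>F. \<forall>g\<in>F. f - g \<in> P \<longrightarrow> f = g)"

text \<open>If \<open>h\<close> lies in \<open>Q\<close> but not in the prime \<open>P\<close>, then the sums \<open>b\<^sub>0 + h b\<^sub>1 + \<dots> + h\<^sup>N b\<^sub>N\<close> with
  \<open>b\<^sub>j\<close> taken from a set of elements incongruent modulo \<open>Q\<close> are incongruent modulo \<open>P\<close>: reduction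
  modulo \<open>Q\<close> recovers \<open>b\<^sub>0\<close>, and \<open>h\<close> may be cancelled modulo \<open>P\<close>.\<close>

lemma incongruent_power_sums:
  fixes P Q :: "('k::{field, finite}, 's::finite) mpoly set"
  assumes P: "prime_ideal P" and Q: "ideal.subspace Q" and "P \<subseteq> Q" and h: "h \<in> Q" "h \<notin> P"
    and deg_h: "exponents_bounded e h"
    and F: "finite F" "incongruent Q F" "\<And>f. f \<in> F \<Longrightarrow> exponents_bounded D f"
  shows "\<exists>F'. finite F' \<and> incongruent P F' \<and> (\<forall>f\<in>F'. exponents_bounded (D + N * e) f)
    \<and> card F' = card F ^ Suc N"
proof (induction N)
  case 0
  have "incongruent P F"
    using F(2) \<open>P \<subseteq> Q\<close> unfolding incongruent_def by blast
  with F show ?case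
    by (intro exI[of _ F]) simp
next
  case (Suc N)
  then obtain G where G: "finite G" "incongruent P G"
    "\<And>f. f \<in> G \<Longrightarrow> exponents_bounded (D + N * e) f" "card G = card F ^ Suc N"
    by blast
  let ?s = "\<lambda>(b, g). b + h * g"
  have cancel: "b = b' \<and> g = g'"
    if "b \<in> F" "b' \<in> F" "g \<in> G" "g' \<in> G" and diff: "(b + h * g) - (b' + h * g') \<in> P" for b b' g g'
  proof -
    have "(b + h * g) - (b' + h * g') \<in> Q"
      using diff \<open>P \<subseteq> Q\<close> by blast
    moreover have "(g - g') * h \<in> Q"
      by (rule ideal.subspace_scale[OF Q h(1)])
    ultimately have "(b + h * g) - (b' + h * g') - (g - g') * h \<in> Q"
      by (rule ideal.subspace_diff[OF Q])
    then have "b - b' \<in> Q"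
      by (simp add: algebra_simps)
    then have b: "b = b'"
      using F(2) that unfolding incongruent_def by blast
    then have "h * (g - g') \<in> P"
      using diff by (simp add: algebra_simps)
    then have "g - g' \<in> P"
      using P h(2) unfolding prime_ideal_def by blast
    then have "g = g'"
      using G(2) that unfolding incongruent_def by blast
    with b show ?thesis ..
  qed
  have P0: "0 \<in> P"
    using P ideal.subspace_0 unfolding prime_ideal_def by blast
  have inj: "inj_on ?s (F \<times> G)"
  proof (rule inj_onI, clarify)
    fix b g b' g' assume *: "b \<in> F" "g \<in> G" "b' \<in> F" "g' \<in> G" "b + h * g = b' + h * g'"
    then have "(b + h * g) - (b' + h * g') \<in> P"
      using P0 by simp
    with * cancel show "b = b' \<and> g = g'" by blast
  qed
  have "incongruent P (?s ` (F \<times> G))"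
    unfolding incongruent_def
  proof (intro ballI impI)
    fix x y assume "x \<in> ?s ` (F \<times> G)" "y \<in> ?s ` (F \<times> G)" and d: "x - y \<in> P"
    then obtain b g b' g' where *: "b \<in> F" "g \<in> G" "b' \<in> F" "g' \<in> G"
      "x = b + h * g" "y = b' + h * g'" by auto
    with d cancel[of b b' g g'] show "x = y" by simp
  qed
  moreover have "exponents_bounded (D + Suc N * e) f" if f: "f \<in> ?s ` (F \<times> G)" for f
  proof -
    obtain b g where bg: "b \<in> F" "g \<in> G" "f = b + h * g"
      using f by auto
    have "exponents_bounded (D + Suc N * e) (h * g)"
      by (rule exponents_bounded_mono[OF exponents_bounded_mult[OF deg_h G(3)[OF bg(2)]]]) simp
    moreover have "exponents_bounded (D + Suc N * e) b"
      by (rule exponents_bounded_mono[OF F(3)[OF bg(1)]]) simp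
    ultimately show ?thesis
      using bg(3) exponents_bounded_add by blast
  qed
  ultimately show ?case
    using F(1) G(1,4) card_image[OF inj]
    by (intro exI[of _ "?s ` (F \<times> G)"]) (simp add: card_cartesian_product)
qed

lemma single_in_ideal_imp_zero:
  fixes P :: "('k::field, 's::finite) mpoly set"
  assumes P: "ideal.subspace P" "P \<noteq> UNIV" and c: "Poly_Mapping.single 0 c \<in> P"
  shows "c = 0"
proof (rule ccontr)
  assume "c \<noteq> 0"
  have "x \<in> P" for x
  proof -
    have "(x * Poly_Mapping.single 0 (inverse c)) * Poly_Mapping.single 0 c \<in> P"
      by (rule ideal.subspace_scale[OF P(1) c])
    then show ?thesis
      using \<open>c \<noteq> 0\<close> by (simp add: mult.assoc mult_single)
  qed
  then show False using P(2) by blast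
qed

lemma incongruent_prime_chain:
  fixes C :: "nat \<Rightarrow> ('k::{field, finite}, 's::finite) mpoly set"
  assumes "\<And>i. i \<le> m \<Longrightarrow> prime_ideal (C i)" "\<And>i. i < m \<Longrightarrow> C i \<subset> C (Suc i)"
  shows "\<exists>E. \<forall>N. \<exists>F. finite F \<and> incongruent (C 0) F \<and> (\<forall>f\<in>F. exponents_bounded (N * E) f)
    \<and> card F = CARD('k) ^ (Suc N ^ m)"
  using assms
proof (induction m arbitrary: C)
  case 0
  let ?F = "Poly_Mapping.single 0 ` (UNIV :: 'k set) :: ('k, 's) mpoly set"
  have "prime_ideal (C 0)"
    using 0(1) by simp
  then have "incongruent (C 0) ?F"
    unfolding incongruent_def prime_ideal_def
    by (auto simp flip: single_diff dest!: single_in_ideal_imp_zero)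
  moreover have "card ?F = CARD('k)"
    by (rule card_image) (meson inj_single)
  moreover have "\<forall>f\<in>?F. exponents_bounded 0 f"
    by (auto simp: exponents_bounded_def)
  ultimately show ?case
    by (intro exI[of _ 0] allI exI[of _ ?F]) auto
next
  case (Suc m)
  have "prime_ideal (C (Suc i))" if "i \<le> m" for i
    using Suc.prems(1) that by simp
  moreover have "C (Suc i) \<subset> C (Suc (Suc i))" if "i < m" for i
    using Suc.prems(2) that by simp
  ultimately obtain E where E: "\<And>N. \<exists>F. finite F \<and> incongruent (C (Suc 0)) F
      \<and> (\<forall>f\<in>F. exponents_bounded (N * E) f) \<and> card F = CARD('k) ^ (Suc N ^ m)"
    using Suc.IH[of "\<lambda>i. C (Suc i)"] by blast
  obtain h where h: "h \<in> C (Suc 0)" "h \<notin> C 0"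
    using Suc.prems(2)[of 0] by auto
  obtain e where e: "exponents_bounded e h"
    using exponents_bounded_exists by blast
  have prime: "prime_ideal (C 0)" "ideal.subspace (C (Suc 0))"
    using Suc.prems(1)[of 0] Suc.prems(1)[of "Suc 0"] by (auto simp: prime_ideal_def)
  have sub: "C 0 \<subseteq> C (Suc 0)"
    using Suc.prems(2)[of 0] by auto
  show ?case
  proof (intro exI[of _ "E + e"] allI)
    fix N
    obtain F where F: "finite F" "incongruent (C (Suc 0)) F"
      "\<And>f. f \<in> F \<Longrightarrow> exponents_bounded (N * E) f" "card F = CARD('k) ^ (Suc N ^ m)"
      using E[of N] by blast
    have "card F ^ Suc N = CARD('k) ^ (Suc N ^ Suc m)"
      unfolding F(4) power_mult[symmetric] power_Suc2[of "Suc N" m] by (rule refl)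
    moreover have "N * E + N * e = N * (E + e)"
      by (rule distrib_left[symmetric])
    moreover note incongruent_power_sums[OF prime sub h e F(1-3), of N]
    ultimately
    show "\<exists>F. finite F \<and> incongruent (C 0) F \<and> (\<forall>f\<in>F. exponents_bounded (N * (E + e)) f)
      \<and> card F = CARD('k) ^ (Suc N ^ Suc m)"
      by (simp only:)
  qed
qed

text \<open>A chain of \<open>m\<close> strict inclusions produces \<open>q ^ ((N + 1) ^ m)\<close> distinct polynomials whose
  exponents are bounded by a constant multiple of \<open>N\<close>, while the number of such polynomials is
  only \<open>q\<close> to the power \<open>O(N ^ s)\<close>.\<close>

theorem prime_chain_length:
  fixes C :: "nat \<Rightarrow> ('k::{field, finite}, 's::finite) mpoly set"
  assumes "\<And>i. i \<le> m \<Longrightarrow> prime_ideal (C i)" "\<And>i. i < m \<Longrightarrow> C i \<subset> C (Suc i)"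
  shows "m \<le> CARD('s)"
proof (rule ccontr)
  assume "\<not> m \<le> CARD('s)"
  then have m: "Suc CARD('s) \<le> m" by simp
  obtain E where E: "\<And>N. \<exists>F. finite F \<and> incongruent (C 0) F
      \<and> (\<forall>f\<in>F. exponents_bounded (N * E) f) \<and> card F = CARD('k) ^ (Suc N ^ m)"
    using incongruent_prime_chain[of m C] assms by blast
  define N where "N = Suc E ^ CARD('s)"
  obtain F :: "('k, 's) mpoly set" where F: "\<forall>f\<in>F. exponents_bounded (N * E) f"
      "card F = CARD('k) ^ (Suc N ^ m)"
    using E[of N] by blast
  have "card F \<le> card {f :: ('k, 's) mpoly. exponents_bounded (N * E) f}"
    using F(1) by (intro card_mono bounded_polynomials(1)) auto
  then have "CARD('k) ^ (Suc N ^ m) \<le> CARD('k) ^ ((N * E + 1) ^ CARD('s))"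
    using bounded_polynomials(2)[where ?'k = 'k and ?'s = 's, of "N * E"] F(2) by simp
  moreover have "card {0 :: 'k, 1} \<le> CARD('k)"
    by (rule card_mono) auto
  then have "1 < CARD('k)" by simp
  ultimately have "Suc N ^ m \<le> (N * E + 1) ^ CARD('s)"
    using power_le_imp_le_exp by blast
  also have "\<dots> \<le> (Suc N * Suc E) ^ CARD('s)"
    by (rule power_mono) auto
  also have "\<dots> = Suc N ^ CARD('s) * N"
    unfolding power_mult_distrib by (simp only: N_def)
  also have "\<dots> < Suc N ^ Suc CARD('s)"
    by simp
  also have "\<dots> \<le> Suc N ^ m"
    by (rule power_increasing[OF m]) simp
  finally show False by simp
qed

text \<open>Every chain of primes ending at \<open>P\<close> can be prolonged by \<open>Q\<close>.\<close>

corollary prime_height_le: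
  fixes P Q :: "('k::{field, finite}, 's::finite) mpoly set"
  assumes "P \<subset> Q" "prime_ideal Q"
  shows "prime_height P \<le> enat (CARD('s) - 1)"
  unfolding prime_height_def
proof (rule Sup_least, clarify)
  fix m and C :: "nat \<Rightarrow> ('k, 's) mpoly set"
  assume C: "\<forall>i\<le>m. prime_ideal (C i)" "\<forall>i<m. C i \<subset> C (Suc i)" and P: "P = C m"
  have "prime_ideal ((C(Suc m := Q)) i)" if "i \<le> Suc m" for i
    using that C(1) assms(2) by (cases "i = Suc m") simp_all
  moreover have "(C(Suc m := Q)) i \<subset> (C(Suc m := Q)) (Suc i)" if "i < Suc m" for i
    using that C(2) assms(1) P by (cases "i = m") simp_all
  ultimately have "Suc m \<le> CARD('s)"
    by (rule prime_chain_length)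
  then show "enat m \<le> enat (CARD('s) - 1)"
    by simp
qed


section \<open>Identifying variables up to scalars\<close>

lemma monom_eq_vec_power:
  "(mpoly_monom a :: ('k::comm_ring_1, 's::finite) mpoly) = vec_power (\<chi> i. indet i) a"
proof -
  have power: "mpoly_monom b ^ n = (mpoly_monom (\<chi> i. n * b $ i) :: ('k, 's) mpoly)" for b n
  proof (induction n)
    case 0
    have "(\<chi> i. 0 * b $ i) = (0 :: nat ^ 's)" by (simp add: vec_eq_iff)
    then show ?case by (metis monom_zero power_0)
  next
    case (Suc n)
    have "b + (\<chi> i. n * b $ i) = (\<chi> i. Suc n * b $ i)"
      by (simp add: vec_eq_iff)
    then show ?case
      by (simp only: power_Suc Suc monom_mult)
  qed
  have prod: "(\<Prod>i\<in>A. mpoly_monom (f i)) = (mpoly_monom (\<Sum>i\<in>A. f i) :: ('k, 's) mpoly)"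
    for A :: "'s set" and f
    by (induction A rule: infinite_finite_induct) (simp_all add: monom_mult)
  have "(\<Sum>i\<in>UNIV. \<chi> j. a $ i * axis i 1 $ j) = a"
    by (simp add: vec_eq_iff axis_def if_distrib cong: if_cong)
  then show ?thesis
    by (simp add: vec_power_def indet_def power prod)
qed

lemma vec_power_congruent:
  fixes x y :: "'r::comm_ring_1 ^ 's::finite"
  assumes P: "ideal.subspace P" and xy: "\<And>i. x $ i - y $ i \<in> P"
  shows "vec_power x a - vec_power y a \<in> P"
proof -
  have mult: "u * u' - v * v' \<in> P" if "u - v \<in> P" "u' - v' \<in> P" for u v u' v'
  proof -
    have "u' * (u - v) + v * (u' - v') \<in> P"
      by (intro ideal.subspace_add[OF P] ideal.subspace_scale[OF P] that)
    then show ?thesis by (simp add: algebra_simps)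
  qed
  have refl: "(u :: 'r) - u \<in> P" for u
    using ideal.subspace_0[OF P] by simp
  have power: "x $ i ^ n - y $ i ^ n \<in> P" for i n
  proof (induction n)
    case (Suc n)
    then show ?case using mult[OF xy[of i] Suc] by simp
  qed (use refl in simp)
  have "(\<Prod>i\<in>A. x $ i ^ a $ i) - (\<Prod>i\<in>A. y $ i ^ a $ i) \<in> P" for A
    by (induction A rule: infinite_finite_induct) (use refl mult power in auto)
  then show ?thesis
    by (simp add: vec_power_def)
qed

text \<open>The substitution \<open>t\<^sub>i = c\<^sub>i t\<^sub>r\<close> for the indices \<open>i \<in> A\<close>. For \<open>r \<notin> A\<close> its kernel is the prime
  ideal generated by the linear forms \<open>t\<^sub>i - c\<^sub>i t\<^sub>r\<close>.\<close>

definition identify :: "'s \<Rightarrow> ('s \<Rightarrow> 'k) \<Rightarrow> 's set \<Rightarrow> ('k::field, 's::finite) mpoly \<Rightarrow> ('k, 's) mpoly" where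
  "identify r c A = extend (Poly_Mapping.single 0)
     (vec_power (\<chi> i. if i \<in> A then Poly_Mapping.single 0 (c i) * indet r else indet i))"

lemma identify_mult: "identify r c A (f * g) = identify r c A f * identify r c A g"
  unfolding identify_def by (rule constant_poly.extend_mult) (rule vec_power_add)

lemma identify_indet:
  "identify r c A (indet i) = (if i \<in> A then Poly_Mapping.single 0 (c i) * indet r else indet i)"
  unfolding identify_def indet_def[of i] constant_poly.extend_monom vec_power_axis by (simp add: indet_def)

lemma prime_ideal_identify_kernel: "prime_ideal {f. identify r c A f = 0}"
proof -
  have "identify r c A 1 = 1"
    unfolding identify_def monom_zero[symmetric] constant_poly.extend_monom by simp
  then have "1 \<notin> {f. identify r c A f = 0}"
    by simp
  then have "{f. identify r c A f = 0} \<noteq> UNIV"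
    by blast
  moreover have "identify r c A (f + g) = identify r c A f + identify r c A g" for f g
    unfolding identify_def by (rule constant_poly.extend_add)
  moreover have "identify r c A 0 = 0"
    unfolding identify_def by simp
  ultimately show ?thesis
    unfolding prime_ideal_def ideal.subspace_def
    by (auto simp: identify_mult dest: mpoly_no_zero_divisors)
qed

lemma identify_congruent:
  assumes P: "ideal.subspace P"
    and forms: "\<And>i. i \<in> A \<Longrightarrow> indet i - Poly_Mapping.single 0 (c i) * indet r \<in> P"
  shows "f - identify r c A f \<in> P"
proof (induction f rule: mpoly_induct)
  case (single a x)
  let ?y = "\<chi> i. if i \<in> A then Poly_Mapping.single 0 (c i) * indet r else indet i"
  have "vec_power (\<chi> i. indet i) a - vec_power ?y a \<in> P"
    by (rule vec_power_congruent[OF P]) (use forms ideal.subspace_0[OF P] in auto)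
  then have "Poly_Mapping.single 0 x * (mpoly_monom a - vec_power ?y a) \<in> P"
    unfolding monom_eq_vec_power by (rule ideal.subspace_scale[OF P])
  then show ?case
    by (simp add: identify_def right_diff_distrib single_eq_scaled_monom[of a x, symmetric])
next
  case (add f g)
  have "(f - identify r c A f) + (g - identify r c A g) \<in> P"
    by (rule ideal.subspace_add[OF P add])
  then show ?case
    by (simp add: identify_def constant_poly.extend_add algebra_simps)
qed

lemma linear_form_in_identify_kernel:
  assumes "r \<notin> A"
  shows "i \<in> A \<Longrightarrow> identify r c A (indet i - Poly_Mapping.single 0 (c i) * indet r) = 0"
    and "i \<notin> A \<Longrightarrow> i \<noteq> r \<Longrightarrow> identify r c A (indet i - Poly_Mapping.single 0 (c i) * indet r) \<noteq> 0"
proof -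
  have const: "identify r c A (Poly_Mapping.single 0 x) = Poly_Mapping.single 0 x" for x
    by (simp add: identify_def)
  have diff: "identify r c A (f - g) = identify r c A f - identify r c A g" for f g
    by (simp add: identify_def constant_poly.extend_diff)
  have *: "identify r c A (indet i - Poly_Mapping.single 0 (c i) * indet r)
      = (if i \<in> A then 0 else indet i - Poly_Mapping.single 0 (c i) * indet r)"
    using assms by (simp add: diff identify_mult identify_indet const)
  then show "i \<in> A \<Longrightarrow> identify r c A (indet i - Poly_Mapping.single 0 (c i) * indet r) = 0"
    by simp
  assume "i \<notin> A" "i \<noteq> r"
  have "Poly_Mapping.lookup (indet i - Poly_Mapping.single 0 (c i) * indet r) (axis i 1) = (1 :: 'b)"
    using \<open>i \<noteq> r\<close>
    by (simp add: lookup_minus indet_def mpoly_monom_def mult_single lookup_single when_def axis_eq_axis)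
  then have "indet i - Poly_Mapping.single 0 (c i) * indet r \<noteq> (0 :: ('b, 'a) mpoly)"
    by (metis lookup_zero zero_neq_one)
  with * \<open>i \<notin> A\<close> show "identify r c A (indet i - Poly_Mapping.single 0 (c i) * indet r) \<noteq> 0"
    by simp
qed

text \<open>Enlarging the set of identified variables one variable at a time gives a chain of
  \<open>s - 1\<close> strict inclusions, whose last member can be replaced by \<open>P\<close>.\<close>

lemma prime_height_ge:
  fixes P :: "('k::field, 's::finite) mpoly set"
  assumes P: "prime_ideal P"
    and forms: "\<And>i. i \<noteq> r \<Longrightarrow> indet i - Poly_Mapping.single 0 (c i) * indet r \<in> P"
  shows "enat (CARD('s) - 1) \<le> prime_height P"
proof -
  let ?n = "CARD('s) - 1"
  obtain e where e: "bij_betw e {0..<?n} (UNIV - {r})"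
    using ex_bij_betw_nat_finite[of "UNIV - {r}"] by auto
  define A where "A k = e ` {..<k}" for k
  have e_neq: "e k \<noteq> r" if "k < ?n" for k
    using bij_betwE[OF e] that by auto
  have A_o: "r \<notin> A k" if "k \<le> ?n" for k
    using e_neq that unfolding A_def by (metis image_iff lessThan_iff less_le_trans)
  have e_A: "e k \<notin> A k" if "k < ?n" for k
    using bij_betw_imp_inj_on[OF e] that unfolding A_def by (auto dest: inj_onD)
  let ?K = "\<lambda>k. {f. identify r c (A k) f = 0}"
  have kernel_below: "?K k \<subset> Q"
    if Q: "ideal.subspace Q" and k: "k < ?n"
      and form: "\<And>j. j \<le> k \<Longrightarrow> indet (e j) - Poly_Mapping.single 0 (c (e j)) * indet r \<in> Q" for k Q
  proof -
    have "f \<in> Q" if f: "f \<in> ?K k" for f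
    proof -
      have "f - identify r c (A k) f \<in> Q"
        by (rule identify_congruent[OF Q]) (use form in \<open>auto simp: A_def\<close>)
      then show ?thesis using f by simp
    qed
    moreover have "indet (e k) - Poly_Mapping.single 0 (c (e k)) * indet r \<notin> ?K k"
      using linear_form_in_identify_kernel(2)[OF A_o e_A e_neq, of k] k by simp
    ultimately show ?thesis
      using form[of k] by blast
  qed
  define C where "C k = (if k < ?n then ?K k else P)" for k
  have "prime_ideal (C k)" for k
    unfolding C_def using P prime_ideal_identify_kernel by auto
  moreover have "C k \<subset> C (Suc k)" if k: "k < ?n" for k
  proof -
    have "ideal.subspace (C (Suc k))"
      using \<open>prime_ideal (C (Suc k))\<close> by (simp add: prime_ideal_def)
    moreover have "indet (e j) - Poly_Mapping.single 0 (c (e j)) * indet r \<in> C (Suc k)" if "j \<le> k" for j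
      using that k forms[OF e_neq, of j]
        linear_form_in_identify_kernel(1)[OF A_o, of "Suc k" "e j" c]
      by (auto simp: C_def A_def)
    ultimately have "?K k \<subset> C (Suc k)"
      by (intro kernel_below k)
    then show ?thesis using k by (simp add: C_def)
  qed
  moreover have "C ?n = P"
    by (simp add: C_def)
  ultimately show ?thesis
    unfolding prime_height_def
    by (intro Sup_upper CollectI exI[of _ ?n] exI[of _ C] conjI allI impI refl)
qed


section \<open>Lattice ideals\<close>

lemma int_vec_add: "int_vec (a + b) = int_vec a + int_vec b"
  by (simp add: int_vec_def vec_eq_iff)

lemma binomial_in_lattice_ideal:
  fixes a b :: "nat ^ 's::finite"
  assumes "int_vec a - int_vec b \<in> L"
  shows "(mpoly_monom a - mpoly_monom b :: ('k::comm_ring_1, 's) mpoly) \<in> lattice_ideal L"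
proof -
  \<comment> \<open>\<open>t\<^sup>c\<close> is the greatest common divisor of \<open>t\<^sup>a\<close> and \<open>t\<^sup>b\<close>.\<close>
  let ?u = "int_vec a - int_vec b" and ?c = "\<chi> i. min (a $ i) (b $ i)"
  have "a = ?c + pos_part ?u" "b = ?c + neg_part ?u"
    by (auto simp: vec_eq_iff int_vec_def pos_part_def neg_part_def)
  then have "mpoly_monom a = (mpoly_monom ?c * mpoly_monom (pos_part ?u) :: ('k, 's) mpoly)"
    "mpoly_monom b = (mpoly_monom ?c * mpoly_monom (neg_part ?u) :: ('k, 's) mpoly)"
    unfolding monom_mult by simp_all
  then have "(mpoly_monom a - mpoly_monom b :: ('k, 's) mpoly)
      = mpoly_monom ?c * (mpoly_monom (pos_part ?u) - mpoly_monom (neg_part ?u))"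
    by (simp add: right_diff_distrib)
  also have "\<dots> \<in> lattice_ideal L"
    unfolding lattice_ideal_def using assms by (intro ideal.span_scale ideal.span_base) blast
  finally show ?thesis .
qed

lemma lattice_subgroup_minus: "lattice_subgroup L \<Longrightarrow> u \<in> L \<Longrightarrow> - u \<in> L"
  unfolding lattice_subgroup_def by (metis diff_0)

lemma lattice_subgroup_diff_iff:
  assumes "lattice_subgroup L" "u - w \<in> L"
  shows "u - z \<in> L \<longleftrightarrow> w - z \<in> L"
proof -
  have "u - z = (u - w) - (z - w)" "w - z = (u - z) - (u - w)" "z - w = - (w - z)"
    by simp_all
  then show ?thesis
    using assms lattice_subgroup_minus unfolding lattice_subgroup_def by metis
qed

text \<open>The sum of the coefficients of \<open>f\<close> at the exponents in one coset of \<open>L\<close>. All these sums vanish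
  on the lattice ideal, so they detect which binomials it contains.\<close>

definition coset_sum :: "(int ^ 's) set \<Rightarrow> int ^ 's \<Rightarrow> ('k::comm_ring_1, 's::finite) mpoly \<Rightarrow> 'k" where
  "coset_sum L z = extend (\<lambda>c. c) (\<lambda>a. if int_vec a - z \<in> L then 1 else 0)"

lemma coset_sum_single_mult:
  "coset_sum L z (Poly_Mapping.single c x * f) = x * coset_sum L (z - int_vec c) f"
proof (induction f rule: mpoly_induct)
  case (single a y)
  have eq: "int_vec (c + a) - z = int_vec a - (z - int_vec c)"
    by (simp add: int_vec_add)
  show ?case
    unfolding coset_sum_def mult_single scalar.extend_single eq by simp
next
  case (add f g)
  then show ?case
    by (simp add: coset_sum_def distrib_left scalar.extend_add)
qed

lemma coset_sum_lattice_ideal: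
  fixes f :: "('k::comm_ring_1, 's::finite) mpoly"
  assumes L: "lattice_subgroup L" and f: "f \<in> lattice_ideal L"
  shows "coset_sum L z f = 0"
proof -
  let ?T = "{f :: ('k, 's) mpoly. \<forall>z. coset_sum L z f = 0}"
  have "p * f \<in> ?T" if f: "f \<in> ?T" for p f
  proof (induction p rule: mpoly_induct)
    case (single a c)
    then show ?case using f by (simp add: coset_sum_single_mult)
  next
    case (add p q)
    then show ?case by (simp add: distrib_right coset_sum_def scalar.extend_add)
  qed
  then have "ideal.subspace ?T"
    unfolding ideal.subspace_def by (simp add: coset_sum_def scalar.extend_add)
  moreover have "mpoly_monom (pos_part u) - mpoly_monom (neg_part u) \<in> ?T" if u: "u \<in> L" for u
    using lattice_subgroup_diff_iff[OF L, of "int_vec (pos_part u)" "int_vec (neg_part u)"] u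
    by (simp add: pos_part_minus_neg_part coset_sum_def scalar.extend_diff)
  ultimately have "lattice_ideal L \<subseteq> ?T"
    unfolding lattice_ideal_def by (intro ideal.span_minimal) blast+
  then show ?thesis
    using f by blast
qed

lemma binomial_in_lattice_ideal_iff:
  fixes a b :: "nat ^ 's::finite"
  assumes L: "lattice_subgroup L"
  shows "(mpoly_monom a - mpoly_monom b :: ('k::field, 's) mpoly) \<in> lattice_ideal L
    \<longleftrightarrow> int_vec a - int_vec b \<in> L"
proof
  assume "(mpoly_monom a - mpoly_monom b :: ('k, 's) mpoly) \<in> lattice_ideal L"
  then have "coset_sum L (int_vec b) (mpoly_monom a - mpoly_monom b :: ('k, 's) mpoly) = 0"
    by (rule coset_sum_lattice_ideal[OF L])
  moreover have "0 \<in> L"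
    using L by (simp add: lattice_subgroup_def)
  ultimately show "int_vec a - int_vec b \<in> L"
    by (auto simp: coset_sum_def scalar.extend_diff split: if_splits)
qed (rule binomial_in_lattice_ideal)

corollary mem_lattice_iff:
  assumes "lattice_subgroup L"
  shows "(mpoly_monom (pos_part u) - mpoly_monom (neg_part u) :: ('k::field, 's::finite) mpoly) \<in> lattice_ideal L
    \<longleftrightarrow> u \<in> L"
  using binomial_in_lattice_ideal_iff[OF assms, of "pos_part u" "neg_part u"]
  by (simp add: pos_part_minus_neg_part)

corollary defining_lattice_lattice_ideal:
  assumes L: "lattice_subgroup L"
  shows "defining_lattice (lattice_ideal L :: ('k::field, 's::finite) mpoly set) = L"
  unfolding defining_lattice_def
proof (rule the_equality)
  fix L' assume L': "lattice_subgroup L' \<and> (lattice_ideal L :: ('k, 's) mpoly set) = lattice_ideal L'"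
  then have "u \<in> L' \<longleftrightarrow> u \<in> L" for u
    using mem_lattice_iff[of L' u, where ?'k = 'k] mem_lattice_iff[OF L, of u, where ?'k = 'k] by simp
  then show "L' = L" by blast
qed (use L in simp)

lemma lattice_subgroup_group_closure: "lattice_subgroup (group_closure B)"
  by (simp add: lattice_subgroup_def group_closure.diff)

lemma group_closure_least:
  assumes "lattice_subgroup L" "B \<subseteq> L"
  shows "group_closure B \<subseteq> L"
proof
  fix u assume "u \<in> group_closure B"
  then show "u \<in> L"
    by induction (use assms in \<open>auto simp: lattice_subgroup_def\<close>)
qed


section \<open>Vanishing ideals of toric sets are lattice ideals\<close>

text \<open>Dedekind's theorem on the linear independence of characters: evaluating a relation at \<open>m x y\<close>
  and subtracting \<open>\<psi> b y\<close> times the relation at \<open>x\<close> gives a relation without the character \<open>\<psi> b\<close>.\<close>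

lemma characters_independent:
  fixes \<psi> :: "'b \<Rightarrow> 'g \<Rightarrow> 'k::idom"
  assumes "finite A"
    and mult: "\<And>x y. x \<in> Y \<Longrightarrow> y \<in> Y \<Longrightarrow> m x y \<in> Y"
    and hom: "\<And>a x y. a \<in> A \<Longrightarrow> x \<in> Y \<Longrightarrow> y \<in> Y \<Longrightarrow> \<psi> a (m x y) = \<psi> a x * \<psi> a y"
    and e: "e \<in> Y" "\<And>a. a \<in> A \<Longrightarrow> \<psi> a e \<noteq> 0"
    and distinct: "\<And>a b. a \<in> A \<Longrightarrow> b \<in> A \<Longrightarrow> \<forall>y\<in>Y. \<psi> a y = \<psi> b y \<Longrightarrow> a = b"
    and zero: "\<And>y. y \<in> Y \<Longrightarrow> (\<Sum>a\<in>A. c a * \<psi> a y) = 0"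
  shows "\<forall>a\<in>A. c a = 0"
  using assms(1) hom e(2) distinct zero
proof (induction A arbitrary: c rule: finite_induct)
  case (insert b A)
  have *: "c a * (\<psi> a y - \<psi> b y) = 0" if a: "a \<in> A" and y: "y \<in> Y" for a y
  proof -
    have "(\<Sum>a\<in>A. (c a * (\<psi> a y - \<psi> b y)) * \<psi> a x) = 0" if x: "x \<in> Y" for x
    proof -
      have "0 = (\<Sum>a\<in>insert b A. c a * \<psi> a (m x y)) - \<psi> b y * (\<Sum>a\<in>insert b A. c a * \<psi> a x)"
        by (simp only: insert.prems(4)[OF mult[OF x y]] insert.prems(4)[OF x] mult_zero_right diff_self)
      also have "\<dots> = (\<Sum>a\<in>insert b A. (c a * (\<psi> a y - \<psi> b y)) * \<psi> a x)"
        unfolding sum_distrib_left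
      proof (subst sum_subtractf[symmetric], rule sum.cong[OF refl])
        fix a assume a: "a \<in> insert b A"
        show "c a * \<psi> a (m x y) - \<psi> b y * (c a * \<psi> a x) = c a * (\<psi> a y - \<psi> b y) * \<psi> a x"
          unfolding insert.prems(1)[OF a x y] by (simp add: algebra_simps)
      qed
      also have "\<dots> = (\<Sum>a\<in>A. (c a * (\<psi> a y - \<psi> b y)) * \<psi> a x)"
        using insert.hyps by simp
      finally show ?thesis by simp
    qed
    moreover have "\<forall>y\<in>Y. \<psi> a y = \<psi> b y \<Longrightarrow> a = b" if "a \<in> A" "b \<in> A" for a b
      using insert.prems(3)[of a b] that by blast
    ultimately show ?thesis
      using insert.IH[of "\<lambda>a. c a * (\<psi> a y - \<psi> b y)"] insert.prems(1,2) a by blast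
  qed
  have A: "c a = 0" if a: "a \<in> A" for a
  proof (rule ccontr)
    assume "c a \<noteq> 0"
    then have "\<forall>y\<in>Y. \<psi> a y = \<psi> b y"
      using *[OF a] by auto
    then show False
      using insert.prems(3)[of a b] insert.hyps(2) a by blast
  qed
  then have "c b * \<psi> b e = 0"
    using insert.prems(4)[OF e(1)] insert.hyps by simp
  then show ?case
    using A insert.prems(2) by auto
qed simp

text \<open>Closure under coordinatewise multiplication makes the monomials into characters of \<open>Y\<close>.\<close>

locale torus_submonoid =
  fixes Y :: "('k::field ^ 's::finite) set"
  assumes nonzero: "y \<in> Y \<Longrightarrow> y $ i \<noteq> 0"
    and mult_closed: "x \<in> Y \<Longrightarrow> y \<in> Y \<Longrightarrow> (\<chi> i. x $ i * y $ i) \<in> Y"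
    and one_closed: "(\<chi> i. 1) \<in> Y"
begin

definition vanishing_lattice :: "(int ^ 's) set" where
  "vanishing_lattice = {int_vec a - int_vec b | a b.
     total_degree a = total_degree b \<and> (\<forall>y\<in>Y. vec_power y a = vec_power y b)}"

lemma vec_power_nonzero: "y \<in> Y \<Longrightarrow> vec_power y a \<noteq> 0"
  by (simp add: vec_power_def nonzero)

lemma mem_vanishing_lattice_iff:
  "int_vec a - int_vec b \<in> vanishing_lattice
    \<longleftrightarrow> total_degree a = total_degree b \<and> (\<forall>y\<in>Y. vec_power y a = vec_power y b)"
proof
  assume "int_vec a - int_vec b \<in> vanishing_lattice"
  then obtain c d where cd: "int_vec a - int_vec b = int_vec c - int_vec d"
    "total_degree c = total_degree d" "\<forall>y\<in>Y. vec_power y c = vec_power y d"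
    unfolding vanishing_lattice_def by blast
  have eq: "a + d = c + b"
  proof -
    have "int (a $ i) - int (b $ i) = int (c $ i) - int (d $ i)" for i
      using arg_cong[OF cd(1), of "\<lambda>u. u $ i"] by (simp add: int_vec_def)
    then have "a $ i + d $ i = c $ i + b $ i" for i
      by (smt (verit) of_nat_add of_nat_eq_iff)
    then show ?thesis by (simp add: vec_eq_iff)
  qed
  then have "total_degree (a + d) = total_degree (c + b)"
    by simp
  then have "total_degree a = total_degree b"
    using cd(2) by (simp add: sum.distrib)
  moreover have "vec_power y a = vec_power y b" if y: "y \<in> Y" for y
  proof -
    have "vec_power y a * vec_power y d = vec_power y b * vec_power y d"
      using eq cd(3) y by (metis vec_power_add mult.commute)
    then show ?thesis using vec_power_nonzero[OF y] by simp
  qed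
  ultimately show "total_degree a = total_degree b \<and> (\<forall>y\<in>Y. vec_power y a = vec_power y b)"
    by blast
qed (auto simp: vanishing_lattice_def)

lemma lattice_subgroup_vanishing_lattice: "lattice_subgroup vanishing_lattice"
  unfolding lattice_subgroup_def
proof (intro conjI ballI)
  show "0 \<in> vanishing_lattice"
    using mem_vanishing_lattice_iff[of 0 0] by simp
  fix u w assume "u \<in> vanishing_lattice" "w \<in> vanishing_lattice"
  then obtain a b c d where u: "u = int_vec a - int_vec b" and w: "w = int_vec c - int_vec d"
    and "total_degree a = total_degree b" "total_degree c = total_degree d"
    and "\<forall>y\<in>Y. vec_power y a = vec_power y b" "\<forall>y\<in>Y. vec_power y c = vec_power y d"
    unfolding vanishing_lattice_def by blast
  then have "int_vec (a + d) - int_vec (b + c) \<in> vanishing_lattice"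
    unfolding mem_vanishing_lattice_iff by (simp add: vec_power_add sum.distrib)
  then show "u - w \<in> vanishing_lattice"
    unfolding u w int_vec_add by (simp add: algebra_simps)
qed

text \<open>On \<open>Y\<close> the monomials are characters. If a homogeneous polynomial vanishes on \<open>Y\<close>, then by
  independence of characters the coefficients of the monomials that induce the same character
  sum to zero, so the polynomial is a combination of differences of such monomials.\<close>

lemma homogeneous_vanishing_in_lattice_ideal:
  assumes hom: "homogeneous f" and zero: "\<And>y. y \<in> Y \<Longrightarrow> mpoly_eval f y = 0"
  shows "f \<in> lattice_ideal vanishing_lattice"
proof -
  let ?K = "Poly_Mapping.keys f" and ?c = "Poly_Mapping.lookup f"
  define ch where "ch a = restrict (\<lambda>y. vec_power y a) Y" for a
  define rep where "rep = inv_into ?K ch"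
  define coeff_sum where "coeff_sum h = (\<Sum>a\<in>{a \<in> ?K. ch a = h}. ?c a)" for h
  have "coeff_sum h = 0" if h: "h \<in> ch ` ?K" for h
  proof -
    have "\<forall>h\<in>ch ` ?K. coeff_sum h = 0"
    proof (rule characters_independent[where Y = Y and m = "\<lambda>x y. \<chi> i. x $ i * y $ i"
          and e = "\<chi> i. 1" and \<psi> = "\<lambda>h. h"])
      show "(\<Sum>h\<in>ch ` ?K. coeff_sum h * h y) = 0" if y: "y \<in> Y" for y
      proof -
        have "0 = (\<Sum>a\<in>?K. ?c a * ch a y)"
          using zero[OF y] y by (simp add: mpoly_eval_extend extend_def ch_def)
        also have "\<dots> = (\<Sum>h\<in>ch ` ?K. \<Sum>a\<in>{a \<in> ?K. ch a = h}. ?c a * ch a y)"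
          by (rule sum.image_gen) simp
        also have "\<dots> = (\<Sum>h\<in>ch ` ?K. coeff_sum h * h y)"
          unfolding coeff_sum_def sum_distrib_right by (intro sum.cong) auto
        finally show ?thesis by simp
      qed
      show "a = b" if "a \<in> ch ` ?K" "b \<in> ch ` ?K" "\<forall>y\<in>Y. a y = b y" for a b
      proof
        fix y
        show "a y = b y"
          using that by (cases "y \<in> Y") (auto simp: ch_def)
      qed
    qed (auto simp: mult_closed one_closed ch_def vec_power_def power_mult_distrib prod.distrib)
    then show ?thesis using h by blast
  qed
  then have "(\<Sum>h\<in>ch ` ?K. Poly_Mapping.single 0 (coeff_sum h) * mpoly_monom (rep h)) = (0 :: ('k, 's) mpoly)"
    by (intro sum.neutral) simp
  also have "(\<Sum>h\<in>ch ` ?K. Poly_Mapping.single 0 (coeff_sum h) * mpoly_monom (rep h))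
      = (\<Sum>h\<in>ch ` ?K. \<Sum>a\<in>{a \<in> ?K. ch a = h}. Poly_Mapping.single 0 (?c a) * (mpoly_monom (rep (ch a)) :: ('k, 's) mpoly))"
  proof (rule sum.cong[OF refl])
    fix h
    have "Poly_Mapping.single 0 (coeff_sum h) = (\<Sum>a\<in>{a \<in> ?K. ch a = h}. Poly_Mapping.single (0 :: nat ^ 's) (?c a))"
      unfolding coeff_sum_def by (induction rule: infinite_finite_induct) (simp_all add: single_add)
    then show "Poly_Mapping.single 0 (coeff_sum h) * mpoly_monom (rep h)
      = (\<Sum>a\<in>{a \<in> ?K. ch a = h}. Poly_Mapping.single 0 (?c a) * (mpoly_monom (rep (ch a)) :: ('k, 's) mpoly))"
      by (simp add: sum_distrib_right)
  qed
  also have "\<dots> = (\<Sum>a\<in>?K. Poly_Mapping.single 0 (?c a) * mpoly_monom (rep (ch a)))"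
    by (rule sum.image_gen[symmetric]) simp
  finally have rest: "(\<Sum>a\<in>?K. Poly_Mapping.single 0 (?c a) * (mpoly_monom (rep (ch a)) :: ('k, 's) mpoly)) = 0" .
  have "f = (\<Sum>a\<in>?K. Poly_Mapping.single 0 (?c a) * mpoly_monom a)"
    by (subst mpoly_expand[of f]) (simp only: single_eq_scaled_monom[symmetric])
  also have "\<dots> = (\<Sum>a\<in>?K. Poly_Mapping.single 0 (?c a) * (mpoly_monom a - mpoly_monom (rep (ch a))))"
    using rest by (simp add: right_diff_distrib sum_subtractf)
  also have "\<dots> \<in> lattice_ideal vanishing_lattice"
    unfolding lattice_ideal_def
  proof (intro ideal.span_sum ideal.span_scale)
    fix a assume a: "a \<in> ?K"
    have r: "rep (ch a) \<in> ?K" "ch (rep (ch a)) = ch a"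
      unfolding rep_def using a by (auto intro: inv_into_into f_inv_into_f)
    then have "total_degree a = total_degree (rep (ch a))"
      using a hom unfolding homogeneous_def by metis
    moreover have "vec_power y a = vec_power y (rep (ch a))" if "y \<in> Y" for y
      using fun_cong[OF r(2), of y] that by (simp add: ch_def)
    ultimately have "int_vec a - int_vec (rep (ch a)) \<in> vanishing_lattice"
      by (simp add: mem_vanishing_lattice_iff)
    then have "mpoly_monom a - mpoly_monom (rep (ch a)) \<in> (lattice_ideal vanishing_lattice :: ('k, 's) mpoly set)"
      by (rule binomial_in_lattice_ideal)
    then show "mpoly_monom a - mpoly_monom (rep (ch a)) \<in> ideal.span
        {mpoly_monom (pos_part a) - mpoly_monom (neg_part a) :: ('k, 's) mpoly |a. a \<in> vanishing_lattice}"
      by (simp add: lattice_ideal_def)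
  qed
  finally show ?thesis .
qed

lemma lattice_binomial_degree:
  assumes "u \<in> vanishing_lattice"
  shows "total_degree (pos_part u) = total_degree (neg_part u)"
  using assms mem_vanishing_lattice_iff[of "pos_part u" "neg_part u"]
  by (simp add: pos_part_minus_neg_part)

lemma lattice_binomial_vanishes:
  assumes "u \<in> vanishing_lattice" "y \<in> Y"
  shows "mpoly_eval (mpoly_monom (pos_part u) - mpoly_monom (neg_part u)) y = 0"
  using assms mem_vanishing_lattice_iff[of "pos_part u" "neg_part u"]
  by (simp add: pos_part_minus_neg_part mpoly_eval_diff)

end

lemma homogeneous_binomial:
  "total_degree a = total_degree b
    \<Longrightarrow> homogeneous (mpoly_monom a - mpoly_monom b :: ('k::comm_ring_1, 's::finite) mpoly)"
  unfolding homogeneous_def mpoly_monom_def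
  by (intro exI[of _ "total_degree a"])
    (auto simp: in_keys_iff lookup_minus lookup_single when_def split: if_splits)

theorem (in torus_submonoid) span_homogeneous_vanishing:
  "ideal.span {f. homogeneous f \<and> (\<forall>y\<in>Y. mpoly_eval f y = 0)} = lattice_ideal vanishing_lattice"
proof (rule ideal.span_subspace)
  show "{f. homogeneous f \<and> (\<forall>y\<in>Y. mpoly_eval f y = 0)} \<subseteq> lattice_ideal vanishing_lattice"
    using homogeneous_vanishing_in_lattice_ideal by blast
  show "lattice_ideal vanishing_lattice \<subseteq> ideal.span {f. homogeneous f \<and> (\<forall>y\<in>Y. mpoly_eval f y = 0)}"
    unfolding lattice_ideal_def
    by (intro ideal.span_mono)
      (auto intro!: homogeneous_binomial lattice_binomial_degree lattice_binomial_vanishes)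
qed (simp add: lattice_ideal_def)

definition torus_points :: "nat ^ 'n ^ 's \<Rightarrow> ('k::field ^ 's::finite) set" where
  "torus_points v = {\<chi> j. vec_power x (v $ j) | x :: 'k ^ 'n::finite. \<forall>i. x $ i \<noteq> 0}"

lemma torus_submonoid_torus_points: "torus_submonoid (torus_points v :: ('k::field ^ 's::finite) set)"
proof
  show "y $ i \<noteq> 0" if "y \<in> torus_points v" for y :: "'k ^ 's" and i
    using that by (auto simp: torus_points_def vec_power_def)
  show "(\<chi> i. x $ i * y $ i) \<in> torus_points v" if "x \<in> torus_points v" "y \<in> torus_points v"
    for x y :: "'k ^ 's"
  proof -
    obtain x' y' where "\<forall>i. x' $ i \<noteq> 0" "\<forall>i. y' $ i \<noteq> 0"
      "x = (\<chi> j. vec_power x' (v $ j))" "y = (\<chi> j. vec_power y' (v $ j))"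
      using \<open>x \<in> _\<close> \<open>y \<in> _\<close> unfolding torus_points_def by blast
    then show ?thesis
      unfolding torus_points_def
      by (intro CollectI exI[of _ "\<chi> i. x' $ i * y' $ i"])
        (simp add: vec_eq_iff vec_power_def power_mult_distrib prod.distrib)
  qed
  show "(\<chi> i. 1) \<in> (torus_points v :: ('k ^ 's) set)"
    unfolding torus_points_def
    by (intro CollectI exI[of _ "\<chi> i. 1"]) (simp add: vec_eq_iff vec_power_def)
qed

lemma homogeneous_eval_scale:
  assumes "homogeneous f"
  obtains d where "\<And>c x. mpoly_eval f (c *s x) = c ^ d * mpoly_eval f x"
proof -
  obtain d where d: "\<And>a. a \<in> Poly_Mapping.keys f \<Longrightarrow> total_degree a = d"
    using assms unfolding homogeneous_def by blast
  have scale: "vec_power (c *s x) a = c ^ total_degree a * vec_power x a" for c x a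
    by (simp add: vec_power_def power_mult_distrib prod.distrib power_sum)
  have "mpoly_eval f (c *s x) = c ^ d * mpoly_eval f x" for c x
    unfolding mpoly_eval_extend extend_def sum_distrib_left
    by (rule sum.cong) (simp_all add: scale d)
  then show thesis by (rule that)
qed

text \<open>A homogeneous polynomial vanishes at all representatives of a projective point as soon as it
  vanishes at one of them.\<close>

lemma vanishing_ideal_toric_set:
  "vanishing_ideal (toric_set v) = (ideal.span {f. homogeneous f \<and> (\<forall>y\<in>torus_points v. mpoly_eval f y = 0)}
      :: ('k::field, 's::finite) mpoly set)"
proof -
  interpret torus_submonoid "torus_points v :: ('k ^ 's) set"
    by (rule torus_submonoid_torus_points)
  have X: "toric_set v = proj_point ` (torus_points v :: ('k ^ 's) set)"
    unfolding toric_set_def torus_points_def vec_power_def by blast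
  have point: "proj_point y = {c *s y | c. c \<noteq> 0}" if y: "y \<in> torus_points v" for y :: "'k ^ 's"
  proof -
    have "c *s y \<noteq> 0" if "c \<noteq> 0" for c
      using that nonzero[OF y] by (auto simp: vec_eq_iff)
    from this[of 1] this show ?thesis
      by (auto simp: proj_point_def proj_rel_def)
  qed
  have "(\<forall>p\<in>toric_set v. \<forall>x\<in>p. mpoly_eval f x = 0) \<longleftrightarrow> (\<forall>y\<in>torus_points v. mpoly_eval f y = 0)"
    if hom: "homogeneous f" for f :: "('k, 's) mpoly"
  proof -
    obtain d where d: "\<And>c x. mpoly_eval f (c *s x) = c ^ d * mpoly_eval f x"
      using homogeneous_eval_scale[OF hom] by blast
    have "(\<forall>x\<in>proj_point y. mpoly_eval f x = 0) \<longleftrightarrow> mpoly_eval f y = 0" if y: "y \<in> torus_points v" for y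
    proof -
      have "1 *s y \<in> proj_point y"
        unfolding point[OF y] by (intro CollectI exI[of _ 1]) simp
      then show ?thesis
        unfolding point[OF y] by (auto simp: d)
    qed
    then show ?thesis
      unfolding X by simp
  qed
  then show ?thesis
    unfolding vanishing_ideal_def by (intro arg_cong[where f = ideal.span]) blast
qed


section \<open>Minimal generation of homogeneous ideals\<close>

definition homogeneous_of_degree :: "nat \<Rightarrow> ('k::comm_ring_1, 's::finite) mpoly \<Rightarrow> bool" where
  "homogeneous_of_degree d f \<longleftrightarrow> (\<forall>a\<in>Poly_Mapping.keys f. total_degree a = d)"

lemma homogeneous_iff: "homogeneous f \<longleftrightarrow> (\<exists>d. homogeneous_of_degree d f)"
  by (simp add: homogeneous_def homogeneous_of_degree_def)

definition graded_part :: "nat \<Rightarrow> ('k::comm_ring_1, 's::finite) mpoly \<Rightarrow> ('k, 's) mpoly" where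
  "graded_part d = extend (Poly_Mapping.single 0) (\<lambda>a. if total_degree a = d then mpoly_monom a else 0)"

lemma graded_part_of_homogeneous:
  fixes f :: "('k::comm_ring_1, 's::finite) mpoly"
  assumes "homogeneous_of_degree e f"
  shows "graded_part d f = (if d = e then f else 0)"
proof (cases "d = e")
  case True
  have "graded_part d f = (\<Sum>a\<in>Poly_Mapping.keys f. Poly_Mapping.single 0 (Poly_Mapping.lookup f a) * mpoly_monom a)"
    unfolding graded_part_def extend_def
    by (rule sum.cong) (use True assms in \<open>auto simp: homogeneous_of_degree_def\<close>)
  also have "\<dots> = f"
    unfolding single_eq_scaled_monom[symmetric] by (rule mpoly_expand[symmetric])
  finally show ?thesis using True by simp
next
  case False
  have "graded_part d f = (\<Sum>a\<in>Poly_Mapping.keys f. 0)"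
    unfolding graded_part_def extend_def
    by (rule sum.cong) (use False assms in \<open>auto simp: homogeneous_of_degree_def\<close>)
  then show ?thesis using False by simp
qed

lemma homogeneous_of_degree_single_mult:
  fixes f :: "('k::comm_ring_1, 's::finite) mpoly"
  assumes "homogeneous_of_degree e f"
  shows "homogeneous_of_degree (total_degree a + e) (Poly_Mapping.single a c * f)"
  unfolding homogeneous_of_degree_def
proof
  fix x assume "x \<in> Poly_Mapping.keys (Poly_Mapping.single a c * f)"
  then obtain u w where "u \<in> Poly_Mapping.keys (Poly_Mapping.single a c)" "w \<in> Poly_Mapping.keys f" "x = u + w"
    using keys_mult[of "Poly_Mapping.single a c" f] by blast
  then show "total_degree x = total_degree a + e"
    using assms by (auto simp: homogeneous_of_degree_def sum.distrib split: if_splits)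
qed

lemma graded_part_add: "graded_part d (f + g) = graded_part d f + graded_part d g"
  unfolding graded_part_def by (rule constant_poly.extend_add)

lemma graded_part_sum: "graded_part d (sum F A) = (\<Sum>x\<in>A. graded_part d (F x))"
  unfolding graded_part_def by (rule constant_poly.extend_sum)

lemma graded_part_zero [simp]: "graded_part d 0 = 0"
  unfolding graded_part_def by simp

lemma graded_part_mult:
  assumes b: "homogeneous_of_degree e b"
  shows "graded_part d (p * b) = (if e \<le> d then graded_part (d - e) p * b else 0)"
proof (induction p rule: mpoly_induct)
  case (single a c)
  have "graded_part d (Poly_Mapping.single a c * b)
      = (if d = total_degree a + e then Poly_Mapping.single a c * b else 0)"
    by (rule graded_part_of_homogeneous[OF homogeneous_of_degree_single_mult[OF b]])
  moreover have "graded_part (d - e) (Poly_Mapping.single a c)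
      = (if d - e = total_degree a then Poly_Mapping.single a c else 0)"
    by (rule graded_part_of_homogeneous) (simp add: homogeneous_of_degree_def)
  ultimately show ?case by auto
next
  case (add f g)
  then show ?case by (simp add: distrib_right graded_part_add)
qed

lemma homogeneous_of_degree_indet:
  "homogeneous_of_degree 1 (indet i :: ('k::comm_ring_1, 's::finite) mpoly)"
  by (simp add: homogeneous_of_degree_def indet_def mpoly_monom_def axis_def)

lemma minus_constant_term_in_irrelevant_ideal:
  fixes p :: "('k::comm_ring_1, 's::finite) mpoly"
  shows "p - Poly_Mapping.single 0 (Poly_Mapping.lookup p 0) \<in> ideal.span (range indet)"
proof (induction p rule: mpoly_induct)
  case (single a c)
  show ?case
  proof (cases "a = 0")
    case True
    then show ?thesis by (simp add: ideal.span_zero)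
  next
    case False
    then obtain i where i: "a $ i \<noteq> 0"
      by (auto simp: vec_eq_iff)
    have "a = (\<chi> j. if j = i then a $ j - 1 else a $ j) + axis i 1"
      using i by (auto simp: vec_eq_iff axis_def)
    then have "Poly_Mapping.single a c
        = Poly_Mapping.single (\<chi> j. if j = i then a $ j - 1 else a $ j) c * (indet i :: ('k, 's) mpoly)"
      by (simp add: indet_def mpoly_monom_def mult_single)
    also have "\<dots> \<in> ideal.span (range indet)"
      by (intro ideal.span_scale ideal.span_base) simp
    finally show ?thesis
      using False by (simp add: lookup_single)
  qed
next
  case (add f g)
  then have "(f - Poly_Mapping.single 0 (Poly_Mapping.lookup f 0))
      + (g - Poly_Mapping.single 0 (Poly_Mapping.lookup g 0)) \<in> ideal.span (range indet)"
    by (rule ideal.span_add)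
  then show ?case by (simp add: lookup_add single_add algebra_simps)
qed

lemma irrelevant_ideal_times_span:
  fixes B :: "('k::comm_ring_1, 's::finite) mpoly set"
  assumes u: "u \<in> ideal.span (range indet)" and f: "f \<in> ideal.span B"
  shows "u * f \<in> ideal.span {indet i * b | i b. b \<in> B}" (is "_ \<in> ?W")
proof -
  have "indet i * f \<in> ?W" for i
    using f
  proof (induction rule: ideal.span_induct_alt)
    case (step c x y)
    have "indet i * x \<in> ?W"
      using step(1) by (intro ideal.span_base) blast
    then have "c * (indet i * x) + indet i * y \<in> ?W"
      using step(2) by (rule ideal.span_add[OF ideal.span_scale])
    then show ?case by (simp add: algebra_simps)
  qed (simp add: ideal.span_zero)
  then have gen: "x * f \<in> ?W" if "x \<in> range indet" for x
    using that by blast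
  show ?thesis
    using u
  proof (induction rule: ideal.span_induct_alt)
    case (step c x y)
    have "c * (x * f) + y * f \<in> ?W"
      by (rule ideal.span_add[OF ideal.span_scale[OF gen[OF step(1)]] step(2)])
    then show ?case by (simp add: algebra_simps)
  qed (simp add: ideal.span_zero)
qed

text \<open>A graded form of Nakayama's lemma. Writing \<open>I\<close> for the ideal and \<open>W = (t\<^sub>1, \<dots>, t\<^sub>s) I\<close>, the quotient
  \<open>I / W\<close> is spanned over the field by the \<open>r\<close> given generators, so a maximal subset \<open>B\<^sub>0\<close> of \<open>B\<close>
  that is independent modulo \<open>W\<close> has at most \<open>r\<close> elements. By maximality \<open>B \<subseteq> (B\<^sub>0) + W\<close>, and
  comparing components of the same degree shows \<open>B \<subseteq> (B\<^sub>0)\<close> by induction on the degree. The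
  dimension bound is obtained by counting linear combinations.\<close>

theorem few_homogeneous_generators:
  fixes B :: "('k::{field, finite}, 's::finite) mpoly set"
  assumes hom: "\<And>b. b \<in> B \<Longrightarrow> homogeneous b"
    and gs: "ideal.span B = ideal.span (set gs)"
  obtains B\<^sub>0 where "B\<^sub>0 \<subseteq> B" "finite B\<^sub>0" "card B\<^sub>0 \<le> length gs" "ideal.span B\<^sub>0 = ideal.span B"
proof -
  define W where "W = ideal.span {indet i * b | i b. b \<in> B}"
  let ?C = "Poly_Mapping.single 0 :: 'k \<Rightarrow> ('k, 's) mpoly"
  let ?r = "length gs"
  have W_sub: "ideal.subspace W"
    unfolding W_def by simp
  have combination: "\<exists>d. f - (\<Sum>i<?r. ?C (d i) * gs ! i) \<in> W" if f: "f \<in> ideal.span B" for f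
    using f unfolding gs
  proof (induction rule: ideal.span_induct_alt)
    case base
    have "0 - (\<Sum>i<?r. ?C 0 * gs ! i) \<in> W"
      using ideal.subspace_0[OF W_sub] by simp
    then show ?case by (rule exI[of _ "\<lambda>_. 0"])
  next
    case (step p g f)
    obtain d where d: "f - (\<Sum>i<?r. ?C (d i) * gs ! i) \<in> W"
      using step(2) by blast
    obtain j where j: "j < ?r" "g = gs ! j"
      using step(1) by (auto simp: in_set_conv_nth)
    let ?p = "Poly_Mapping.lookup p 0"
    have "(\<Sum>i<?r. ?C (d i + (if i = j then ?p else 0)) * gs ! i)
        = (\<Sum>i<?r. ?C (d i) * gs ! i + (if i = j then ?C ?p * g else 0))"
      using j(2) by (intro sum.cong) (auto simp: single_add distrib_right)
    also have "\<dots> = (\<Sum>i<?r. ?C (d i) * gs ! i) + ?C ?p * g"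
      using j(1) by (simp add: sum.distrib)
    finally have sum: "(\<Sum>i<?r. ?C (d i + (if i = j then ?p else 0)) * gs ! i)
        = (\<Sum>i<?r. ?C (d i) * gs ! i) + ?C ?p * g" .
    have "g \<in> ideal.span B"
      unfolding gs using step(1) by (rule ideal.span_base)
    then have "(p - ?C ?p) * g \<in> W"
      unfolding W_def by (intro irrelevant_ideal_times_span minus_constant_term_in_irrelevant_ideal)
    then have "(p - ?C ?p) * g + (f - (\<Sum>i<?r. ?C (d i) * gs ! i)) \<in> W"
      using d by (rule ideal.subspace_add[OF W_sub])
    then have "p * g + f - (\<Sum>i<?r. ?C (d i + (if i = j then ?p else 0)) * gs ! i) \<in> W"
      unfolding sum by (simp add: algebra_simps)
    then show ?case
      by (rule exI[of _ "\<lambda>i. d i + (if i = j then ?p else 0)"])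
  qed
  define indep where "indep F \<longleftrightarrow> finite F \<and> F \<subseteq> B
    \<and> (\<forall>c. (\<Sum>b\<in>F. ?C (c b) * b) \<in> W \<longrightarrow> (\<forall>b\<in>F. c b = 0))" for F
  have indep_card: "card F \<le> ?r" if F: "indep F" for F
  proof -
    let ?comb = "\<lambda>c. \<Sum>b\<in>F. ?C (c b) * b"
    have "?comb c \<in> ideal.span B" for c
      using F by (intro ideal.span_sum ideal.span_scale ideal.span_base) (auto simp: indep_def)
    then have "\<forall>c. \<exists>d. ?comb c - (\<Sum>i<?r. ?C (d i) * gs ! i) \<in> W"
      by (intro allI combination)
    from choice[OF this] obtain d where d: "\<And>c. ?comb c - (\<Sum>i<?r. ?C (d c i) * gs ! i) \<in> W"
      by blast
    let ?A = "PiE F (\<lambda>_. UNIV :: 'k set)" and ?T = "PiE {..<?r} (\<lambda>_. UNIV :: 'k set)"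
    have "inj_on (\<lambda>c. restrict (d c) {..<?r}) ?A"
    proof (rule inj_onI)
      fix c c' assume c: "c \<in> ?A" "c' \<in> ?A" and eq: "restrict (d c) {..<?r} = restrict (d c') {..<?r}"
      have "d c i = d c' i" if "i < ?r" for i
        using fun_cong[OF eq, of i] that by simp
      then have "(\<Sum>i<?r. ?C (d c i) * gs ! i) = (\<Sum>i<?r. ?C (d c' i) * gs ! i)"
        by simp
      then have "?comb c - ?comb c' \<in> W"
        using ideal.subspace_diff[OF W_sub d[of c] d[of c']] by simp
      moreover have "?comb c - ?comb c' = ?comb (\<lambda>b. c b - c' b)"
        by (simp add: single_diff left_diff_distrib sum_subtractf)
      ultimately have "\<forall>b\<in>F. c b - c' b = 0"
        using F unfolding indep_def by auto
      then show "c = c'"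
        using c by (intro PiE_ext) auto
    qed
    moreover have "(\<lambda>c. restrict (d c) {..<?r}) ` ?A \<subseteq> ?T"
      by (intro image_subsetI) (simp add: restrict_PiE_iff)
    moreover have "finite ?T"
      by (simp add: finite_PiE)
    ultimately have "card ?A \<le> card ?T"
      by (rule card_inj_on_le)
    moreover have "finite F"
      using F by (simp add: indep_def)
    ultimately have "CARD('k) ^ card F \<le> CARD('k) ^ ?r"
      by (simp add: card_PiE)
    moreover have "card {0 :: 'k, 1} \<le> CARD('k)"
      by (rule card_mono) auto
    then have "1 < CARD('k)" by simp
    ultimately show ?thesis
      using power_le_imp_le_exp by blast
  qed
  have "indep {}"
    by (simp add: indep_def)
  moreover have "\<forall>F. indep F \<longrightarrow> card F < Suc ?r"
    using indep_card by (simp add: less_Suc_eq_le)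
  ultimately obtain B\<^sub>0 where B\<^sub>0: "indep B\<^sub>0" and max: "\<And>F. indep F \<Longrightarrow> card F \<le> card B\<^sub>0"
    using ex_has_greatest_nat[of indep "{}" card "Suc ?r"] by blast
  have fin: "finite B\<^sub>0" and B\<^sub>0_B: "B\<^sub>0 \<subseteq> B"
    using B\<^sub>0 by (auto simp: indep_def)
  have reduce: "\<exists>c. b - (\<Sum>x\<in>B\<^sub>0. ?C (c x) * x) \<in> W" if b: "b \<in> B" for b
  proof (cases "b \<in> B\<^sub>0")
    case True
    have "(\<Sum>x\<in>B\<^sub>0. ?C (if x = b then 1 else 0) * x) = (\<Sum>x\<in>B\<^sub>0. if x = b then b else 0)"
      by (rule sum.cong) auto
    also have "\<dots> = b"
      using True fin by simp
    finally have "b - (\<Sum>x\<in>B\<^sub>0. ?C (if x = b then 1 else 0) * x) \<in> W"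
      using ideal.subspace_0[OF W_sub] by simp
    then show ?thesis by (rule exI[of _ "\<lambda>x. if x = b then 1 else 0"])
  next
    case False
    then have "\<not> indep (insert b B\<^sub>0)"
      using max[of "insert b B\<^sub>0"] fin by auto
    then obtain c where c: "(\<Sum>x\<in>insert b B\<^sub>0. ?C (c x) * x) \<in> W" "\<exists>x\<in>insert b B\<^sub>0. c x \<noteq> 0"
      using b fin B\<^sub>0_B unfolding indep_def by auto
    have c_sum: "?C (c b) * b + (\<Sum>x\<in>B\<^sub>0. ?C (c x) * x) \<in> W"
      using c(1) False fin by simp
    have cb: "c b \<noteq> 0"
    proof
      assume "c b = 0"
      then show False
        using c_sum c(2) B\<^sub>0 unfolding indep_def by auto
    qed
    have "?C (inverse (c b)) * (?C (c b) * b + (\<Sum>x\<in>B\<^sub>0. ?C (c x) * x)) \<in> W"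
      by (rule ideal.subspace_scale[OF W_sub c_sum])
    moreover have "?C (inverse (c b)) * (?C (c b) * b) = b"
      using cb by (simp add: mult.assoc[symmetric] mult_single)
    moreover have "?C (inverse (c b)) * (\<Sum>x\<in>B\<^sub>0. ?C (c x) * x)
        = - (\<Sum>x\<in>B\<^sub>0. ?C (- (inverse (c b) * c x)) * x)"
      by (simp add: sum_distrib_left mult.assoc[symmetric] mult_single single_uminus sum_negf)
    ultimately have "b - (\<Sum>x\<in>B\<^sub>0. ?C (- (inverse (c b) * c x)) * x) \<in> W"
      by (simp add: distrib_left)
    then show ?thesis by (rule exI[of _ "\<lambda>x. - (inverse (c b) * c x)"])
  qed
  \<comment> \<open>The generators \<open>t\<^sub>i b\<close> of \<open>W\<close> have larger degree than \<open>b\<close>, so a component of degree \<open>d\<close> involves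
    only those \<open>b\<close> that have smaller degree.\<close>
  have lower: "graded_part d w \<in> ideal.span {b \<in> B. \<exists>e<d. homogeneous_of_degree e b}"
    (is "_ \<in> ?L d") if w: "w \<in> W" for w d
    using w unfolding W_def
  proof (induction rule: ideal.span_induct_alt)
    case (step p x w)
    then obtain i b where x: "x = indet i * b" and b: "b \<in> B" by blast
    obtain e where e: "homogeneous_of_degree e b"
      using hom[OF b] homogeneous_iff by blast
    have "graded_part d (p * x) \<in> ?L d"
    proof (cases "e < d")
      case True
      have "graded_part (d - e) (p * indet i) * b \<in> ?L d"
        using True e b by (intro ideal.span_scale ideal.span_base) blast
      then show ?thesis
        using True graded_part_mult[OF e, of d "p * indet i"] unfolding x by (simp add: mult.assoc)
    next
      case False
      have "graded_part 0 (p * indet i) = 0"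
        using graded_part_mult[OF homogeneous_of_degree_indet, of 0 p i] by simp
      then have "graded_part d (p * x) = 0"
        using False graded_part_mult[OF e, of d "p * indet i"] unfolding x by (simp add: mult.assoc)
      then show ?thesis by (simp add: ideal.span_zero)
    qed
    then show ?case
      unfolding graded_part_add using step by (intro ideal.span_add)
  qed (simp add: ideal.span_zero)
  have "\<forall>b\<in>B. homogeneous_of_degree d b \<longrightarrow> b \<in> ideal.span B\<^sub>0" for d
  proof (induction d rule: less_induct)
    case (less d)
    show ?case
    proof (intro ballI impI)
      fix b assume b: "b \<in> B" "homogeneous_of_degree d b"
      obtain c where c: "b - (\<Sum>x\<in>B\<^sub>0. ?C (c x) * x) \<in> W"
        using reduce[OF b(1)] by blast
      have eq: "graded_part d b = graded_part d (b - (\<Sum>x\<in>B\<^sub>0. ?C (c x) * x))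
          + (\<Sum>x\<in>B\<^sub>0. graded_part d (?C (c x) * x))"
        unfolding graded_part_sum[symmetric] graded_part_add[symmetric] by simp
      have "?L d \<subseteq> ideal.span B\<^sub>0"
        using less by (intro ideal.span_minimal) auto
      then have "graded_part d (b - (\<Sum>x\<in>B\<^sub>0. ?C (c x) * x)) \<in> ideal.span B\<^sub>0"
        using lower[OF c] by blast
      moreover have "(\<Sum>x\<in>B\<^sub>0. graded_part d (?C (c x) * x)) \<in> ideal.span B\<^sub>0"
      proof (rule ideal.span_sum)
        fix x assume x: "x \<in> B\<^sub>0"
        obtain e where e: "homogeneous_of_degree e x"
          using hom x B\<^sub>0_B homogeneous_iff by blast
        show "graded_part d (?C (c x) * x) \<in> ideal.span B\<^sub>0"
          unfolding graded_part_mult[OF e]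
          using x by (simp add: ideal.span_zero ideal.span_scale ideal.span_base)
      qed
      ultimately have "graded_part d b \<in> ideal.span B\<^sub>0"
        unfolding eq by (rule ideal.span_add)
      then show "b \<in> ideal.span B\<^sub>0"
        using graded_part_of_homogeneous[OF b(2), of d] by simp
    qed
  qed
  then have "B \<subseteq> ideal.span B\<^sub>0"
    using hom homogeneous_iff by blast
  then have "ideal.span B\<^sub>0 = ideal.span B"
    using B\<^sub>0_B ideal.span_superset[of B] unfolding ideal.span_eq by blast
  with B\<^sub>0_B fin indep_card[OF B\<^sub>0] show thesis
    by (intro that)
qed


section \<open>Congruences on exponent vectors\<close>

text \<open>For an ideal \<open>J\<close>, the relation \<open>t\<^sup>x - t\<^sup>y \<in> J\<close> is a congruence of the additive monoid of exponent
  vectors. The vectors \<open>x\<close> and \<open>y\<close> are then congruent if their difference lies in the lattice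
  generated by some binomials of \<open>J\<close>, provided that these binomials are distributed over the
  variables in a suitable way.\<close>

locale exponent_congruence =
  fixes R :: "nat ^ 's::finite \<Rightarrow> nat ^ 's \<Rightarrow> bool"
  assumes cong_refl: "R x x"
    and cong_sym: "R x y \<Longrightarrow> R y x"
    and cong_trans: "R x y \<Longrightarrow> R y z \<Longrightarrow> R x z"
    and cong_add: "R x y \<Longrightarrow> R (x + z) (y + z)"

definition saturated :: "(nat ^ 's::finite \<Rightarrow> nat ^ 's \<Rightarrow> bool) \<Rightarrow> (int ^ 's) set \<Rightarrow> bool" where
  "saturated R G \<longleftrightarrow> (\<forall>x y. int_vec x - int_vec y \<in> G \<longrightarrow> R x y)"

definition restrict_vec :: "'s set \<Rightarrow> 'a::zero ^ 's \<Rightarrow> 'a ^ 's" where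
  "restrict_vec D x = (\<chi> i. if i \<in> D then x $ i else 0)"

definition pos_support :: "int ^ 's \<Rightarrow> 's set" where
  "pos_support u = {i. 0 < u $ i}"

definition neg_support :: "int ^ 's \<Rightarrow> 's set" where
  "neg_support u = {i. u $ i < 0}"

lemma (in exponent_congruence) cong_add2:
  assumes "R x y" "R x' y'"
  shows "R (x + x') (y + y')"
proof (rule cong_trans)
  show "R (x + x') (y + x')"
    by (rule cong_add[OF assms(1)])
  show "R (y + x') (y + y')"
    using cong_add[OF assms(2), of y] by (simp add: add.commute)
qed

lemma (in exponent_congruence) cong_multiple: "R x y \<Longrightarrow> R (\<chi> i. n * x $ i) (\<chi> i. n * y $ i)"
proof (induction n)
  case (Suc n)
  have "(\<chi> i. Suc n * z $ i) = z + (\<chi> i. n * z $ i)" for z :: "nat ^ 's"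
    by (simp add: vec_eq_iff)
  then show ?case
    using cong_add2 Suc by simp
qed (simp add: cong_refl)

text \<open>Suppose \<open>u\<^sup>+\<close> lives on \<open>D\<^sub>1\<close> and \<open>u\<^sup>-\<close> on a disjoint \<open>D\<^sub>2\<close>, and \<open>G\<close> splits along
  \<open>D\<^sub>1\<close>, \<open>D\<^sub>2\<close> and the remaining variables. To pass from \<open>x\<close> to \<open>y\<close>, change the part on \<open>D\<^sub>1\<close> from
  \<open>x\<^sub>1\<close> to \<open>y\<^sub>1 + n u\<^sup>+\<close>, replace \<open>n u\<^sup>+\<close> by \<open>n u\<^sup>-\<close>, and absorb the latter into the part on \<open>D\<^sub>2\<close>.\<close>

lemma (in exponent_congruence) cong_across_blocks:
  assumes sat: "saturated R G"
    and split: "\<And>D w. D \<in> {D\<^sub>1, D\<^sub>2, - (D\<^sub>1 \<union> D\<^sub>2)} \<Longrightarrow> w \<in> G \<Longrightarrow> restrict_vec D w \<in> G"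
    and disj: "D\<^sub>1 \<inter> D\<^sub>2 = {}"
    and u: "pos_support u \<subseteq> D\<^sub>1" "neg_support u \<subseteq> D\<^sub>2" "R (pos_part u) (neg_part u)"
    and w: "w \<in> G" and xy: "\<And>i. int (x $ i) - int (y $ i) = w $ i + int n * u $ i"
  shows "R x y"
proof -
  let ?D\<^sub>3 = "- (D\<^sub>1 \<union> D\<^sub>2)"
  let ?p = "\<chi> i. n * pos_part u $ i" and ?m = "\<chi> i. n * neg_part u $ i"
  have u1: "u $ i \<ge> 0" if "i \<notin> D\<^sub>2" for i
    using u(2) that unfolding neg_support_def by (metis mem_Collect_eq not_less subsetD)
  have u2: "u $ i \<le> 0" if "i \<notin> D\<^sub>1" for i
    using u(1) that unfolding pos_support_def by (metis mem_Collect_eq not_less subsetD)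
  have pos: "int (pos_part u $ i) = (if i \<in> D\<^sub>1 then u $ i else 0)" for i
    using disj u1[of i] u2[of i] by (auto simp: pos_part_def)
  have neg: "int (neg_part u $ i) = (if i \<in> D\<^sub>2 then - u $ i else 0)" for i
    using disj u1[of i] u2[of i] by (auto simp: neg_part_def)
  have eq1: "int_vec (restrict_vec D\<^sub>1 x) - int_vec (restrict_vec D\<^sub>1 y + ?p) = restrict_vec D\<^sub>1 w"
    using xy by (simp add: vec_eq_iff int_vec_def restrict_vec_def pos algebra_simps)
  have 1: "R (restrict_vec D\<^sub>1 x) (restrict_vec D\<^sub>1 y + ?p)"
    using sat split[OF _ w, of D\<^sub>1] unfolding saturated_def eq1[symmetric] by blast
  have eq2: "int_vec (restrict_vec D\<^sub>2 x + ?m) - int_vec (restrict_vec D\<^sub>2 y) = restrict_vec D\<^sub>2 w"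
    using xy by (simp add: vec_eq_iff int_vec_def restrict_vec_def neg algebra_simps)
  have 2: "R (restrict_vec D\<^sub>2 x + ?m) (restrict_vec D\<^sub>2 y)"
    using sat split[OF _ w, of D\<^sub>2] unfolding saturated_def eq2[symmetric] by blast
  have eq3: "int_vec (restrict_vec ?D\<^sub>3 x) - int_vec (restrict_vec ?D\<^sub>3 y) = restrict_vec ?D\<^sub>3 w"
  proof -
    have "u $ i = 0" if "i \<in> ?D\<^sub>3" for i
      using u1[of i] u2[of i] that by simp
    then show ?thesis
      using xy by (simp add: vec_eq_iff int_vec_def restrict_vec_def)
  qed
  have 3: "R (restrict_vec ?D\<^sub>3 x) (restrict_vec ?D\<^sub>3 y)"
    using sat split[OF _ w, of ?D\<^sub>3] unfolding saturated_def eq3[symmetric] by blast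
  have decompose: "z = restrict_vec D\<^sub>1 z + (restrict_vec D\<^sub>2 z + restrict_vec ?D\<^sub>3 z)" for z :: "nat ^ 's"
    using disj by (auto simp: vec_eq_iff restrict_vec_def)
  have "R x ((restrict_vec D\<^sub>1 y + ?p) + (restrict_vec D\<^sub>2 x + restrict_vec ?D\<^sub>3 x))"
    by (subst decompose[of x]) (rule cong_add[OF 1])
  also have "(restrict_vec D\<^sub>1 y + ?p) + (restrict_vec D\<^sub>2 x + restrict_vec ?D\<^sub>3 x)
      = ?p + (restrict_vec D\<^sub>1 y + restrict_vec D\<^sub>2 x + restrict_vec ?D\<^sub>3 x)"
    by (simp add: ac_simps)
  finally have step1: "R x (?p + (restrict_vec D\<^sub>1 y + restrict_vec D\<^sub>2 x + restrict_vec ?D\<^sub>3 x))" .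
  have step2: "R (?p + (restrict_vec D\<^sub>1 y + restrict_vec D\<^sub>2 x + restrict_vec ?D\<^sub>3 x))
      (?m + (restrict_vec D\<^sub>1 y + restrict_vec D\<^sub>2 x + restrict_vec ?D\<^sub>3 x))"
    by (rule cong_add[OF cong_multiple[OF u(3)]])
  have eq: "?m + (restrict_vec D\<^sub>1 y + restrict_vec D\<^sub>2 x + restrict_vec ?D\<^sub>3 x)
      = restrict_vec D\<^sub>1 y + ((restrict_vec D\<^sub>2 x + ?m) + restrict_vec ?D\<^sub>3 x)"
    by (simp add: ac_simps)
  have "R (restrict_vec D\<^sub>1 y + ((restrict_vec D\<^sub>2 x + ?m) + restrict_vec ?D\<^sub>3 x))
      (restrict_vec D\<^sub>1 y + (restrict_vec D\<^sub>2 y + restrict_vec ?D\<^sub>3 y))"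
    by (intro cong_add2 cong_refl 2 3)
  then have "R (restrict_vec D\<^sub>1 y + ((restrict_vec D\<^sub>2 x + ?m) + restrict_vec ?D\<^sub>3 x)) y"
    by (simp only: decompose[of y, symmetric])
  then show ?thesis
    by (rule cong_trans[OF step1 cong_trans[OF step2, unfolded eq]])
qed

lemma group_closure_insertD:
  fixes u :: "int ^ 's::finite"
  assumes "z \<in> group_closure (insert u B)"
  obtains w n where "w \<in> group_closure B" "z = w + n *s u"
proof -
  have "\<exists>w\<in>group_closure B. \<exists>n. z = w + n *s u"
    using assms
  proof induction
    case (base s)
    then consider "s = 0" | "s = u" | "s \<in> B" by blast
    then show ?case
    proof cases
      case 2
      then show ?thesis by (intro bexI[of _ 0] exI[of _ 1]) (simp_all add: vec_eq_iff)
    next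
      case 3
      then show ?thesis
        by (intro bexI[of _ s] exI[of _ 0]) (auto simp: vec_eq_iff intro: group_closure.base)
    qed (intro bexI[of _ 0] exI[of _ 0]; simp add: vec_eq_iff)
  next
    case (diff s t)
    then obtain w n w' n' where "w \<in> group_closure B" "s = w + n *s u" "w' \<in> group_closure B" "t = w' + n' *s u"
      by blast
    then show ?case
      by (intro bexI[of _ "w - w'"] exI[of _ "n - n'"])
        (auto simp: vec_eq_iff algebra_simps intro: group_closure.diff)
  qed
  then show thesis using that by blast
qed

lemma restrict_vec_group_closure:
  fixes B :: "(int ^ 's::finite) set"
  assumes blocks: "\<And>b. b \<in> B \<Longrightarrow> \<exists>g. \<forall>i. b $ i \<noteq> 0 \<longrightarrow> \<beta> i = g"
    and w: "w \<in> group_closure B"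
  shows "restrict_vec {i. \<beta> i \<in> T} w \<in> group_closure B"
  using w
proof induction
  case (base s)
  show ?case
  proof (cases "s = 0")
    case True
    then have "restrict_vec {i. \<beta> i \<in> T} s = 0"
      by (simp add: restrict_vec_def vec_eq_iff)
    then show ?thesis by simp
  next
    case False
    then have s: "s \<in> B" using base by simp
    obtain g where "\<And>i. s $ i \<noteq> 0 \<Longrightarrow> \<beta> i = g"
      using blocks[OF s] by blast
    then have "restrict_vec {i. \<beta> i \<in> T} s = (if g \<in> T then s else 0)"
      by (auto simp: restrict_vec_def vec_eq_iff)
    then show ?thesis
      using s by (simp add: group_closure.base)
  qed
next
  case (diff s t)
  have "restrict_vec {i. \<beta> i \<in> T} (s - t) = restrict_vec {i. \<beta> i \<in> T} s - restrict_vec {i. \<beta> i \<in> T} t"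
    by (simp add: restrict_vec_def vec_eq_iff)
  then show ?case
    using diff.IH by (simp add: group_closure.diff)
qed

text \<open>The combinatorial core of the sufficiency of the three conditions. The covering hypothesis says
  that the indicator vector of a proper nonempty set of variables is not a common zero of the
  binomials. Start with
  one block per variable. Every block, being a proper set of variables, contains one of the two
  sides of a vector that has not been used yet; there are more blocks than unused vectors, so two
  blocks share a vector, whose sides lie in one block each. Merge these two blocks and use up the
  vector. After \<open>s - 1\<close> steps all variables form a single block and all vectors are used.\<close>

theorem (in exponent_congruence) saturated_group_closure:
  fixes a :: "'i \<Rightarrow> int ^ 's"
  assumes I: "finite I" "card I = CARD('s) - 1"
    and sum_zero: "\<And>l. l \<in> I \<Longrightarrow> (\<Sum>i\<in>UNIV. a l $ i) = 0"
    and cover: "\<And>C. C \<noteq> {} \<Longrightarrow> C \<noteq> UNIV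
      \<Longrightarrow> \<exists>l\<in>I. (pos_support (a l) \<subseteq> C) \<noteq> (neg_support (a l) \<subseteq> C)"
    and gen: "\<And>l. l \<in> I \<Longrightarrow> R (pos_part (a l)) (neg_part (a l))"
  shows "saturated R (group_closure (a ` I))"
proof -
  have supports: "pos_support (a l) = {} \<longleftrightarrow> neg_support (a l) = {}" if l: "l \<in> I" for l
  proof
    assume "pos_support (a l) = {}"
    then have nonpos: "- a l $ i \<ge> 0" for i
      by (auto simp: pos_support_def not_less)
    have "(\<Sum>i\<in>UNIV. - a l $ i) = 0"
      using sum_zero[OF l] by (simp add: sum_negf)
    then have "- a l $ i = 0" for i
      using nonpos by (subst (asm) sum_nonneg_eq_0_iff) auto
    then show "neg_support (a l) = {}"
      by (simp add: neg_support_def)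
  next
    assume "neg_support (a l) = {}"
    then have "a l $ i \<ge> 0" for i
      by (auto simp: neg_support_def not_less)
    then have "a l $ i = 0" for i
      using sum_zero[OF l] by (subst (asm) sum_nonneg_eq_0_iff) auto
    then show "pos_support (a l) = {}"
      by (simp add: pos_support_def)
  qed
  have "\<exists>U (\<beta> :: 's \<Rightarrow> 's). U \<subseteq> I \<and> card U = n \<and> card (range \<beta>) = CARD('s) - n
      \<and> (\<forall>l\<in>U. \<exists>g. \<forall>i. a l $ i \<noteq> 0 \<longrightarrow> \<beta> i = g)
      \<and> saturated R (group_closure (a ` U))"
    if "n \<le> CARD('s) - 1" for n
    using that
  proof (induction n)
    case 0
    have "R x y" if "int_vec x - int_vec y = 0" for x y :: "nat ^ 's"
    proof -
      have "x = y"
        using that by (simp add: vec_eq_iff int_vec_def)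
      then show ?thesis using cong_refl by simp
    qed
    then have "saturated R (group_closure (a ` {}))"
      by (simp add: saturated_def)
    then show ?case
      by (intro exI[of _ "{}"] exI[of _ id]) simp
  next
    case (Suc n)
    then obtain U and \<beta> :: "'s \<Rightarrow> 's" where U: "U \<subseteq> I" "card U = n" and card_\<beta>: "card (range \<beta>) = CARD('s) - n"
      and blocks: "\<And>l. l \<in> U \<Longrightarrow> \<exists>g. \<forall>i. a l $ i \<noteq> 0 \<longrightarrow> \<beta> i = g"
      and sat: "saturated R (group_closure (a ` U))"
      by auto
    define block where "block g = {i. \<beta> i = g}" for g
    have "\<exists>l\<in>I. (pos_support (a l) \<subseteq> block g) \<noteq> (neg_support (a l) \<subseteq> block g)" if g: "g \<in> range \<beta>" for g
    proof (rule cover)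
      show "block g \<noteq> {}"
        using g by (auto simp: block_def)
      show "block g \<noteq> UNIV"
      proof
        assume "block g = UNIV"
        then have "range \<beta> = {g}"
          by (auto simp: block_def)
        then have "CARD('s) - n = 1"
          using card_\<beta> by simp
        then show False using Suc.prems by simp
      qed
    qed
    then obtain l where l: "\<And>g. g \<in> range \<beta> \<Longrightarrow> l g \<in> I"
      "\<And>g. g \<in> range \<beta> \<Longrightarrow> (pos_support (a (l g)) \<subseteq> block g) \<noteq> (neg_support (a (l g)) \<subseteq> block g)"
      by metis
    have unused: "l g \<notin> U" if g: "g \<in> range \<beta>" for g
    proof
      assume "l g \<in> U"
      then obtain g' where g': "\<And>i. a (l g) $ i \<noteq> 0 \<Longrightarrow> \<beta> i = g'"
        using blocks by blast
      then have "pos_support (a (l g)) \<subseteq> block g'" "neg_support (a (l g)) \<subseteq> block g'"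
        by (auto simp: pos_support_def neg_support_def block_def)
      moreover have "block g \<inter> block g' = {} \<or> g = g'"
        by (auto simp: block_def)
      ultimately show False
        using l(2)[OF g] supports[OF l(1)[OF g]] by blast
    qed
    have fin: "finite U"
      using U(1) I(1) finite_subset by blast
    have "\<not> inj_on l (range \<beta>)"
    proof
      assume "inj_on l (range \<beta>)"
      moreover have "l ` range \<beta> \<subseteq> I - U"
        using l(1) unused by blast
      ultimately have "card (range \<beta>) \<le> card (I - U)"
        using I(1) by (intro card_inj_on_le) auto
      then show False
        using card_\<beta> card_Diff_subset[OF fin U(1)] U(2) I(2) Suc.prems by simp
    qed
    then obtain g h where gh: "g \<in> range \<beta>" "h \<in> range \<beta>" "g \<noteq> h" "l g = l h"
      unfolding inj_on_def by blast
    define k where "k = l g"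
    have k: "k \<in> I" "k \<notin> U"
      using l(1) unused gh(1) by (auto simp: k_def)
    have "block g \<inter> block h = {}"
      using gh(3) by (auto simp: block_def)
    then have "pos_support (a k) \<subseteq> block g \<and> neg_support (a k) \<subseteq> block h
        \<or> pos_support (a k) \<subseteq> block h \<and> neg_support (a k) \<subseteq> block g"
      using l(2)[OF gh(1)] l(2)[OF gh(2)] supports[OF k(1)] unfolding gh(4)[symmetric] k_def[symmetric]
      by blast
    then obtain D\<^sub>1 D\<^sub>2 where D: "{D\<^sub>1, D\<^sub>2} = {g, h}" "pos_support (a k) \<subseteq> block D\<^sub>1" "neg_support (a k) \<subseteq> block D\<^sub>2"
      by blast
    have D_neq: "D\<^sub>1 \<noteq> D\<^sub>2"
      using D(1) gh(3) by (auto simp: doubleton_eq_iff)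
    define \<beta>' where "\<beta>' i = (if \<beta> i = h then g else \<beta> i)" for i
    have "range \<beta>' = range \<beta> - {h}"
      using gh by (auto simp: \<beta>'_def image_iff)
    then have "card (range \<beta>') = CARD('s) - Suc n"
      using gh(2) card_\<beta> by simp
    moreover have "\<exists>g. \<forall>i. a l $ i \<noteq> 0 \<longrightarrow> \<beta>' i = g" if l: "l \<in> insert k U" for l
    proof (cases "l = k")
      case True
      have "\<beta>' i = g" if "a k $ i \<noteq> 0" for i
      proof -
        have "i \<in> pos_support (a k) \<union> neg_support (a k)"
          using that by (simp add: pos_support_def neg_support_def neq_iff disj_commute)
        then have "i \<in> block D\<^sub>1 \<union> block D\<^sub>2"
          using D(2,3) by blast
        then have "\<beta> i \<in> {g, h}"
          using D(1) by (auto simp: block_def)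
        then show ?thesis by (auto simp: \<beta>'_def)
      qed
      then show ?thesis using True by blast
    next
      case False
      then obtain g' where "\<forall>i. a l $ i \<noteq> 0 \<longrightarrow> \<beta> i = g'"
        using blocks[of l] l by blast
      then have "\<forall>i. a l $ i \<noteq> 0 \<longrightarrow> \<beta>' i = (if g' = h then g else g')"
        by (simp add: \<beta>'_def)
      then show ?thesis by blast
    qed
    moreover have "saturated R (group_closure (a ` insert k U))"
      unfolding saturated_def
    proof (intro allI impI)
      fix x y :: "nat ^ 's" assume xy: "int_vec x - int_vec y \<in> group_closure (a ` insert k U)"
      let ?G = "group_closure (a ` U)"
      obtain w n where w: "w \<in> ?G" and eq: "int_vec x - int_vec y = w + n *s a k"
        using xy group_closure_insertD[of _ "a k" "a ` U"] by auto
      have eq_i: "int (x $ i) - int (y $ i) = w $ i + n * a k $ i" for i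
        using arg_cong[OF eq, of "\<lambda>z. z $ i"] by (simp add: int_vec_def)
      have split: "restrict_vec D w' \<in> ?G"
        if D': "D \<in> {block D\<^sub>1, block D\<^sub>2, - (block D\<^sub>1 \<union> block D\<^sub>2)}" and w': "w' \<in> ?G" for D w'
      proof -
        have "D \<in> {{i. \<beta> i \<in> T} | T. True}"
          using D' unfolding block_def
          by (auto intro: exI[of _ "{D\<^sub>1}"] exI[of _ "{D\<^sub>2}"] exI[of _ "- {D\<^sub>1, D\<^sub>2}"])
        then obtain T where "D = {i. \<beta> i \<in> T}" by blast
        then show ?thesis
          using restrict_vec_group_closure[of "a ` U" \<beta> w' T] blocks w' by auto
      qed
      have disj: "block D\<^sub>1 \<inter> block D\<^sub>2 = {}"
        using D_neq by (auto simp: block_def)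
      note across = cong_across_blocks[OF sat split disj D(2,3) gen[OF k(1)]]
      show "R x y"
      proof (cases "n \<ge> 0")
        case True
        then show ?thesis
          using eq_i by (intro across[OF _ _ w, of x y "nat n"]) auto
      next
        case False
        have "int (y $ i) - int (x $ i) = (- w) $ i + int (nat (- n)) * a k $ i" for i
          using eq_i[of i] False by (simp add: algebra_simps)
        moreover have "- w \<in> ?G"
          using w by simp
        ultimately have "R y x"
          by (intro across[of "- w" y x "nat (- n)"])
        then show ?thesis by (rule cong_sym)
      qed
    qed
    ultimately show ?case
      using U k fin by (intro exI[of _ "insert k U"] exI[of _ \<beta>']) simp
  qed
  from this[of "CARD('s) - 1"] obtain U where U: "U \<subseteq> I" "card U = CARD('s) - 1"
    "saturated R (group_closure (a ` U))"
    by auto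
  have "U = I"
    using U(1,2) I card_subset_eq by metis
  then show ?thesis using U(3) by simp
qed


section \<open>The height of the vanishing ideal\<close>

lemma homogeneous_of_degree_mult:
  assumes "homogeneous_of_degree d f" "homogeneous_of_degree e g"
  shows "homogeneous_of_degree (d + e) (f * g)"
  unfolding homogeneous_of_degree_def
proof
  fix x assume "x \<in> Poly_Mapping.keys (f * g)"
  then obtain u w where "u \<in> Poly_Mapping.keys f" "w \<in> Poly_Mapping.keys g" "x = u + w"
    using keys_mult[of f g] by blast
  then show "total_degree x = d + e"
    using assms by (simp add: homogeneous_of_degree_def sum.distrib)
qed

lemma homogeneous_prod:
  fixes f :: "'a \<Rightarrow> ('k::comm_ring_1, 's::finite) mpoly"
  assumes "\<And>a. a \<in> A \<Longrightarrow> homogeneous (f a)"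
  shows "homogeneous (prod f A)"
  using assms
proof (induction A rule: infinite_finite_induct)
  case (insert a A)
  then obtain d e where "homogeneous_of_degree d (f a)" "homogeneous_of_degree e (prod f A)"
    unfolding homogeneous_iff by blast
  then show ?case
    using insert.hyps homogeneous_of_degree_mult[of d "f a" e "prod f A"]
    by (auto simp: homogeneous_iff)
qed (auto simp: homogeneous_def)

lemma homogeneous_linear_form:
  "homogeneous (indet i - Poly_Mapping.single 0 c * indet j :: ('k::comm_ring_1, 's::finite) mpoly)"
  unfolding homogeneous_iff homogeneous_of_degree_def
proof (intro exI ballI)
  fix a assume "a \<in> Poly_Mapping.keys (indet i - Poly_Mapping.single 0 c * indet j :: ('k, 's) mpoly)"
  then have "a = axis i 1 \<or> a = axis j 1"
    by (auto simp: in_keys_iff lookup_minus indet_def mpoly_monom_def mult_single lookup_single when_def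
        split: if_splits)
  then show "total_degree a = 1"
    by (auto simp: axis_def)
qed

lemma prime_ideal_prodD:
  assumes P: "prime_ideal P" and "finite A" "prod f A \<in> P"
  shows "\<exists>a\<in>A. f a \<in> P"
  using assms(2,3)
proof induction
  case empty
  have "x * 1 \<in> P" for x
    using P empty ideal.subspace_scale[of P 1 x] by (simp add: prime_ideal_def)
  then show ?case using P by (auto simp: prime_ideal_def)
next
  case (insert a A)
  then show ?case using P by (auto simp: prime_ideal_def)
qed

lemma prime_ideal_vanishing_at_zero:
  "prime_ideal {f :: ('k::field, 's::finite) mpoly. mpoly_eval f 0 = 0}"
proof -
  have "1 \<notin> {f :: ('k, 's) mpoly. mpoly_eval f 0 = 0}"
    by simp
  then have "{f :: ('k, 's) mpoly. mpoly_eval f 0 = 0} \<noteq> UNIV"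
    by blast
  then show ?thesis
    unfolding prime_ideal_def using ideal_subspace_eval_zero by (simp add: mpoly_eval_mult)
qed

locale finite_torus_submonoid = torus_submonoid Y
  for Y :: "('k::{field, finite} ^ 's::finite) set"
begin

abbreviation toric_ideal :: "('k, 's) mpoly set" where
  "toric_ideal \<equiv> lattice_ideal vanishing_lattice"

text \<open>At a point of \<open>Y\<close> the ratio of two coordinates is one of the finitely many nonzero scalars.\<close>

lemma prod_linear_forms_in_toric_ideal:
  "(\<Prod>c\<in>UNIV - {0}. indet i - Poly_Mapping.single 0 c * indet j) \<in> toric_ideal"
proof (rule homogeneous_vanishing_in_lattice_ideal)
  show "homogeneous (\<Prod>c\<in>UNIV - {0}. indet i - Poly_Mapping.single 0 c * indet j :: ('k, 's) mpoly)"
    by (rule homogeneous_prod) (rule homogeneous_linear_form)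
  fix y assume y: "y \<in> Y"
  have "y $ i / y $ j \<in> UNIV - {0}" "y $ i - y $ i / y $ j * y $ j = 0"
    using nonzero[OF y] by simp_all
  then show "mpoly_eval (\<Prod>c\<in>UNIV - {0}. indet i - Poly_Mapping.single 0 c * indet j :: ('k, 's) mpoly) y = 0"
    unfolding mpoly_eval_prod
    by (intro prod_zero bexI[of _ "y $ i / y $ j"]) (simp_all add: mpoly_eval_diff mpoly_eval_mult)
qed

text \<open>The prime ideal of the point \<open>(1, \<dots>, 1)\<close>, which lies on \<open>Y\<close>, contains the toric ideal; its height
  is at most \<open>s - 1\<close> because it is properly contained in the irrelevant ideal. Conversely, a prime
  ideal that contains the toric ideal contains one factor of each of the products of linear forms
  above, hence the ideal of a line through the origin, which has height \<open>s - 1\<close>.\<close>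

theorem toric_ideal_height: "ideal_height toric_ideal = enat (CARD('s) - 1)"
proof (rule antisym)
  fix r :: 's
  let ?P = "{f :: ('k, 's) mpoly. identify r (\<lambda>_. 1) (UNIV - {r}) f = 0}"
  let ?M = "{f :: ('k, 's) mpoly. mpoly_eval f 0 = 0}"
  have "(\<chi> i. if i \<in> UNIV - {r} then Poly_Mapping.single 0 1 * indet r else indet i) = (\<chi> i. (indet r :: ('k, 's) mpoly))"
    by (simp add: vec_eq_iff)
  then have identify_monom: "identify r (\<lambda>_. 1) (UNIV - {r}) (mpoly_monom a :: ('k, 's) mpoly) = indet r ^ total_degree a" for a
    by (simp only: identify_def constant_poly.extend_monom) (simp add: vec_power_def power_sum)
  have "mpoly_monom (pos_part u) - mpoly_monom (neg_part u) \<in> ?P" if "u \<in> vanishing_lattice" for u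
    using identify_monom lattice_binomial_degree[OF that]
    by (simp add: identify_def constant_poly.extend_diff)
  moreover have "ideal.subspace ?P"
    using prime_ideal_identify_kernel[of r "\<lambda>_. 1" "UNIV - {r}"] unfolding prime_ideal_def by blast
  ultimately have toric: "toric_ideal \<subseteq> ?P"
    unfolding lattice_ideal_def by (intro ideal.span_minimal) blast+
  have "?P \<subset> ?M"
  proof
    show "?P \<subseteq> ?M"
    proof
      fix f assume f: "f \<in> ?P"
      have "f - identify r (\<lambda>_. 1) (UNIV - {r}) f \<in> ?M"
        by (rule identify_congruent[OF ideal_subspace_eval_zero]) (simp add: mpoly_eval_diff mpoly_eval_mult)
      then show "f \<in> ?M" using f by simp
    qed
    have "mpoly_eval (indet r) (\<chi> i. 1) \<noteq> (0 :: 'k)"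
      by simp
    then have "indet r \<noteq> (0 :: ('k, 's) mpoly)"
      by (metis mpoly_eval_zero)
    then have "indet r \<notin> ?P" "indet r \<in> ?M"
      by (simp_all add: identify_indet)
    then show "?P \<noteq> ?M" by blast
  qed
  then have "prime_height ?P \<le> enat (CARD('s) - 1)"
    using prime_ideal_vanishing_at_zero by (rule prime_height_le)
  moreover have "ideal_height toric_ideal \<le> prime_height ?P"
    unfolding ideal_height_def using toric prime_ideal_identify_kernel by (intro Inf_lower) blast
  ultimately show "ideal_height toric_ideal \<le> enat (CARD('s) - 1)"
    by (rule order_trans[rotated])
next
  show "enat (CARD('s) - 1) \<le> ideal_height toric_ideal"
    unfolding ideal_height_def
  proof (rule Inf_greatest, clarify)
    fix P :: "('k, 's) mpoly set" assume P: "prime_ideal P" "toric_ideal \<subseteq> P"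
    fix r :: 's
    have "\<exists>c. indet i - Poly_Mapping.single 0 c * indet r \<in> P" for i
      using prime_ideal_prodD[OF P(1) finite subsetD[OF P(2) prod_linear_forms_in_toric_ideal[of i r]]] by blast
    then obtain c where "\<And>i. indet i - Poly_Mapping.single 0 (c i) * indet r \<in> P"
      by metis
    then show "enat (CARD('s) - 1) \<le> prime_height P"
      by (intro prime_height_ge[OF P(1)])
  qed
qed


section \<open>The characterization of complete intersections\<close>

abbreviation lattice_binomial :: "int ^ 's \<Rightarrow> ('k, 's) mpoly" where
  "lattice_binomial u \<equiv> mpoly_monom (pos_part u) - mpoly_monom (neg_part u)"

lemma exponent_diff_lattice_binomial: "exponent_diff (lattice_binomial u) \<in> {u, - u}"
  using exponent_diff_mpoly_monom[of "pos_part u" "neg_part u", where ?'k = 'k]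
    pos_part_minus_neg_part[of u] by (metis minus_diff_eq)

lemma zero_set_toric_ideal_indet: "zero_set (ideal.span (toric_ideal \<union> {indet j})) = {0}"
  unfolding zero_set_span
proof
  show "zero_set (toric_ideal \<union> {indet j}) \<subseteq> {0}"
  proof
    fix x assume x: "x \<in> zero_set (toric_ideal \<union> {indet j})"
    then have xj: "x $ j = 0"
      by (auto simp: zero_set_def)
    have "x $ i = 0" for i
    proof -
      have "mpoly_eval (\<Prod>c\<in>UNIV - {0}. indet i - Poly_Mapping.single 0 c * indet j :: ('k, 's) mpoly) x = 0"
        using x prod_linear_forms_in_toric_ideal[of i j] by (simp add: zero_set_def)
      then have "(\<Prod>c\<in>UNIV - {0 :: 'k}. x $ i) = 0"
        by (simp add: mpoly_eval_prod mpoly_eval_diff mpoly_eval_mult xj)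
      then show ?thesis by simp
    qed
    then show "x \<in> {0}" by (simp add: vec_eq_iff)
  qed
  have power_zero: "vec_power (0 :: 'k ^ 's) a = (if total_degree a = 0 then 1 else 0)" for a
    by (auto simp: vec_power_def power_0_left)
  have "lattice_binomial u \<in> {f. mpoly_eval f 0 = 0}" if "u \<in> vanishing_lattice" for u
    unfolding mem_Collect_eq mpoly_eval_diff mpoly_eval_monom power_zero
      lattice_binomial_degree[OF that] by (rule diff_self)
  then have "toric_ideal \<subseteq> {f. mpoly_eval f 0 = 0}"
    unfolding lattice_ideal_def
    by (intro ideal.span_minimal ideal_subspace_eval_zero) blast
  then show "{0} \<subseteq> zero_set (toric_ideal \<union> {indet j})"
    by (auto simp: zero_set_def)
qed

lemma vec_power_indicator:
  "vec_power (\<chi> i. if i \<in> C then 1 else (0 :: 'r::comm_ring_1)) (a :: nat ^ 's)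
    = (if \<forall>i. i \<notin> C \<longrightarrow> a $ i = 0 then 1 else 0)"
proof (cases "\<forall>i. i \<notin> C \<longrightarrow> a $ i = 0")
  case True
  then show ?thesis
    by (auto simp: vec_power_def intro!: prod.neutral)
next
  case False
  then obtain i where i: "i \<notin> C" "a $ i \<noteq> 0" by blast
  then have "vec_power (\<chi> i. if i \<in> C then 1 else (0 :: 'r)) a = 0"
    unfolding vec_power_def by (intro prod_zero bexI[of _ i]) (auto simp: power_0_left)
  then show ?thesis using False by simp
qed

text \<open>The lattice binomials are homogeneous and generate the toric ideal, so by the graded form of
  Nakayama's lemma at most as many of them are needed as there are elements in any given system
  of generators.\<close>

theorem complete_intersection_toric_ideal_imp:
  assumes "complete_intersection toric_ideal"
  obtains a :: "nat \<Rightarrow> int ^ 's" where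
    "\<And>i. a i \<in> vanishing_lattice"
    "toric_ideal = ideal.span ((\<lambda>i. lattice_binomial (a i)) ` {1..CARD('s) - 1})"
proof -
  let ?n = "CARD('s) - 1"
  obtain gs where gs: "toric_ideal = ideal.span (set gs)" "length gs = ?n"
    using assms unfolding complete_intersection_def toric_ideal_height by auto
  let ?B = "lattice_binomial ` vanishing_lattice"
  have B: "toric_ideal = ideal.span ?B"
    unfolding lattice_ideal_def by (simp add: image_def setcompr_eq_image)
  have hom: "homogeneous b" if "b \<in> ?B" for b
    using that lattice_binomial_degree by (auto intro: homogeneous_binomial)
  have "ideal.span ?B = ideal.span (set gs)"
    using gs(1) B by simp
  from few_homogeneous_generators[OF hom this]
  obtain B\<^sub>0 where B\<^sub>0: "B\<^sub>0 \<subseteq> ?B" "finite B\<^sub>0" "card B\<^sub>0 \<le> ?n" "ideal.span B\<^sub>0 = toric_ideal"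
    unfolding gs(2) B by blast
  obtain U where U: "U \<subseteq> vanishing_lattice" "inj_on lattice_binomial U" "B\<^sub>0 = lattice_binomial ` U"
    using subset_image_inj[of B\<^sub>0 lattice_binomial vanishing_lattice] B\<^sub>0(1) by blast
  have U_fin: "finite U" "card U \<le> ?n"
    using B\<^sub>0(2,3) U(2,3) by (auto simp: finite_image_iff card_image)
  obtain e where e: "bij_betw e {1..card U} U"
    using ex_bij_betw_nat_finite_1[OF U_fin(1)] by blast
  \<comment> \<open>Fewer than \<open>s - 1\<close> generators are supplemented by copies of \<open>t\<^sup>0 - t\<^sup>0 = 0\<close>.\<close>
  define a where "a i = (if i \<in> {1..card U} then e i else 0)" for i
  have "0 \<in> vanishing_lattice"
    using lattice_subgroup_vanishing_lattice by (simp add: lattice_subgroup_def)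
  then have a: "a i \<in> vanishing_lattice" for i
    using bij_betwE[OF e] U(1) unfolding a_def by auto
  have "a ` {1..card U} = U"
    using bij_betw_imp_surj_on[OF e] by (auto simp: a_def)
  then have "U \<subseteq> a ` {1..?n}"
    using image_mono[of "{1..card U}" "{1..?n}" a] U_fin(2) by auto
  then have "B\<^sub>0 \<subseteq> (\<lambda>i. lattice_binomial (a i)) ` {1..?n}"
    unfolding U(3) by blast
  then have "toric_ideal \<subseteq> ideal.span ((\<lambda>i. lattice_binomial (a i)) ` {1..?n})"
    unfolding B\<^sub>0(4)[symmetric] by (rule ideal.span_mono)
  moreover have "ideal.span ((\<lambda>i. lattice_binomial (a i)) ` {1..?n}) \<subseteq> toric_ideal"
    unfolding B using a by (intro ideal.span_mono) blast
  ultimately show thesis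
    using a that by blast
qed

text \<open>The lattice can be read off from any system of binomial generators: it is contained in every
  lattice whose ideal contains these generators.\<close>

lemma vanishing_lattice_generated:
  assumes a: "\<And>i. i \<in> J \<Longrightarrow> a i \<in> vanishing_lattice"
    and span: "toric_ideal = ideal.span ((\<lambda>i. lattice_binomial (a i)) ` J)"
  shows "vanishing_lattice = group_closure ((\<lambda>i. exponent_diff (lattice_binomial (a i))) ` J)"
    (is "_ = ?G")
proof
  have G: "lattice_subgroup ?G"
    by (rule lattice_subgroup_group_closure)
  have "a i \<in> ?G" if "i \<in> J" for i
  proof -
    have "exponent_diff (lattice_binomial (a i)) \<in> ?G"
      using that by (intro group_closure.base) blast
    then show ?thesis
      using exponent_diff_lattice_binomial[of "a i"] by auto
  qed
  then have "(\<lambda>i. lattice_binomial (a i)) ` J \<subseteq> lattice_ideal ?G"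
    using mem_lattice_iff[OF G, where ?'k = 'k] by blast
  then have "toric_ideal \<subseteq> lattice_ideal ?G"
    unfolding span by (rule ideal.span_minimal) (simp add: lattice_ideal_def)
  then show "vanishing_lattice \<subseteq> ?G"
    using mem_lattice_iff[OF G, where ?'k = 'k]
      mem_lattice_iff[OF lattice_subgroup_vanishing_lattice, where ?'k = 'k] by blast
  have "exponent_diff (lattice_binomial (a i)) \<in> vanishing_lattice" if "i \<in> J" for i
    using exponent_diff_lattice_binomial[of "a i"] a[OF that]
      lattice_subgroup_minus[OF lattice_subgroup_vanishing_lattice] by auto
  then show "?G \<subseteq> vanishing_lattice"
    by (intro group_closure_least lattice_subgroup_vanishing_lattice) blast
qed

text \<open>The hypothesis on zero sets is applied to the indicator vectors of sets of variables. The
  binomial \<open>t\<^sup>a - t\<^sup>b\<close> takes a nonzero value at the indicator vector of \<open>C\<close> exactly if one but not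
  the other of \<open>a\<close> and \<open>b\<close> is supported in \<open>C\<close>.\<close>

theorem toric_ideal_generated:
  assumes J: "finite J" "card J = CARD('s) - 1"
    and a: "\<And>i. i \<in> J \<Longrightarrow> a i \<in> vanishing_lattice"
    and lattice: "vanishing_lattice = group_closure ((\<lambda>i. exponent_diff (lattice_binomial (a i))) ` J)"
    and zero: "\<And>j. zero_set (ideal.span ((\<lambda>i. lattice_binomial (a i)) ` J \<union> {indet j})) = {0}"
  shows "toric_ideal = ideal.span ((\<lambda>i. lattice_binomial (a i)) ` J)" (is "_ = ?I")
proof
  define R where "R x y \<longleftrightarrow> (mpoly_monom x - mpoly_monom y :: ('k, 's) mpoly) \<in> ?I" for x y
  interpret exponent_congruence R
  proof
    show "R x x" for x
      by (simp add: R_def ideal.span_zero)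
    show "R y x" if "R x y" for x y
      using ideal.span_neg[OF that[unfolded R_def]] by (simp add: R_def)
    show "R x z" if "R x y" "R y z" for x y z
      using ideal.span_add[OF that[unfolded R_def]] by (simp add: R_def)
    show "R (x + z) (y + z)" if "R x y" for x y z
      using ideal.span_scale[OF that[unfolded R_def], of "mpoly_monom z"]
      by (simp add: R_def right_diff_distrib monom_mult add.commute)
  qed
  have sum_zero: "(\<Sum>i\<in>UNIV. a l $ i) = 0" if l: "l \<in> J" for l
  proof -
    have "int (pos_part (a l) $ i) - int (neg_part (a l) $ i) = a l $ i" for i
      by (simp add: pos_part_def neg_part_def)
    then have "(\<Sum>i\<in>UNIV. a l $ i) = int (total_degree (pos_part (a l))) - int (total_degree (neg_part (a l)))"
      by (simp add: sum_subtractf[symmetric])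
    then show ?thesis
      using lattice_binomial_degree[OF a[OF l]] by simp
  qed
  have cover: "\<exists>l\<in>J. (pos_support (a l) \<subseteq> C) \<noteq> (neg_support (a l) \<subseteq> C)" if C: "C \<noteq> {}" "C \<noteq> UNIV" for C
  proof -
    obtain i j where ij: "i \<in> C" "j \<notin> C"
      using C by blast
    let ?x = "\<chi> i. if i \<in> C then 1 else (0 :: 'k)"
    have "?x $ i \<noteq> 0"
      using ij(1) by simp
    then have "?x \<noteq> 0"
      by (metis zero_index)
    then have "?x \<notin> zero_set ((\<lambda>i. lattice_binomial (a i)) ` J \<union> {indet j})"
      using zero[of j] by (simp add: zero_set_span)
    moreover have "mpoly_eval (indet j) ?x = 0"
      using ij(2) by simp
    ultimately obtain l where l: "l \<in> J" "mpoly_eval (lattice_binomial (a l)) ?x \<noteq> 0"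
      by (auto simp: zero_set_def)
    have supports: "(\<forall>i. i \<notin> C \<longrightarrow> pos_part (a l) $ i = 0) \<longleftrightarrow> pos_support (a l) \<subseteq> C"
      "(\<forall>i. i \<notin> C \<longrightarrow> neg_part (a l) $ i = 0) \<longleftrightarrow> neg_support (a l) \<subseteq> C"
      by (force simp: pos_part_def neg_part_def pos_support_def neg_support_def)+
    have "(pos_support (a l) \<subseteq> C) \<noteq> (neg_support (a l) \<subseteq> C)"
      using l(2) unfolding mpoly_eval_diff mpoly_eval_monom vec_power_indicator supports
      by (metis diff_self)
    then show ?thesis using l(1) by blast
  qed
  have gen: "R (pos_part (a l)) (neg_part (a l))" if "l \<in> J" for l
    unfolding R_def using that by (intro ideal.span_base) blast
  have sat: "saturated R (group_closure (a ` J))"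
    using J sum_zero cover gen by (rule saturated_group_closure)
  have "exponent_diff (lattice_binomial (a i)) \<in> group_closure (a ` J)" if "i \<in> J" for i
  proof -
    have "a i \<in> group_closure (a ` J)"
      using that by (intro group_closure.base) blast
    then show ?thesis
      using exponent_diff_lattice_binomial[of "a i"] by auto
  qed
  then have "vanishing_lattice \<subseteq> group_closure (a ` J)"
    unfolding lattice by (intro group_closure_least lattice_subgroup_group_closure) blast
  then have "int_vec (pos_part u) - int_vec (neg_part u) \<in> group_closure (a ` J)"
    if "u \<in> vanishing_lattice" for u
    using that unfolding pos_part_minus_neg_part by blast
  then have "lattice_binomial u \<in> ?I" if "u \<in> vanishing_lattice" for u
    using sat that unfolding saturated_def R_def by blast
  then show "toric_ideal \<subseteq> ?I"
    unfolding lattice_ideal_def by (intro ideal.span_minimal ideal.subspace_span) blast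
  show "?I \<subseteq> toric_ideal"
    unfolding lattice_ideal_def using a by (intro ideal.span_mono) blast
qed

end

theorem corollary3p2:
  fixes v :: "nat ^ 'n::finite ^ 's::finite"
    and X :: "('k::{field, finite} ^ 's) set set"
  assumes "X = toric_set v"
  shows "complete_intersection (vanishing_ideal X) \<longleftrightarrow>
    (\<exists>h :: nat \<Rightarrow> ('k, 's) mpoly.
       (\<forall>i\<in>{1..CARD('s) - 1}. is_binomial (h i) \<and> homogeneous (h i) \<and> h i \<in> vanishing_ideal X) \<and>
       defining_lattice (vanishing_ideal X)
         = group_closure ((\<lambda>i. exponent_diff (h i)) ` {1..CARD('s) - 1}) \<and>
       (\<forall>j :: 's. zero_set (ideal.span (h ` {1..CARD('s) - 1} \<union> {indet j})) = {0}) \<and>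
       (\<forall>i\<in>{1..CARD('s) - 1}. \<exists>a :: int ^ 's.
          h i = mpoly_monom (pos_part a) - mpoly_monom (neg_part a)))"
proof -
  interpret finite_torus_submonoid "torus_points v :: ('k ^ 's) set"
    unfolding finite_torus_submonoid_def by (rule torus_submonoid_torus_points)
  have I: "vanishing_ideal X = toric_ideal"
    unfolding assms vanishing_ideal_toric_set by (rule span_homogeneous_vanishing)
  have L: "defining_lattice toric_ideal = vanishing_lattice"
    by (rule defining_lattice_lattice_ideal[OF lattice_subgroup_vanishing_lattice])
  let ?J = "{1..CARD('s) - 1}"
  show ?thesis
    unfolding I L
  proof
    assume "complete_intersection toric_ideal"
    then obtain a where a: "\<And>i. a i \<in> vanishing_lattice"
      and span: "toric_ideal = ideal.span ((\<lambda>i. lattice_binomial (a i)) ` ?J)"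
      using complete_intersection_toric_ideal_imp by blast
    let ?h = "\<lambda>i. lattice_binomial (a i)"
    have "ideal.span (?h ` ?J \<union> {indet j}) = ideal.span (toric_ideal \<union> {indet j})" for j
      unfolding span ideal.span_Un ideal.span_span by (rule refl)
    then have "\<forall>j. zero_set (ideal.span (?h ` ?J \<union> {indet j})) = {0}"
      using zero_set_toric_ideal_indet by simp
    moreover have "vanishing_lattice = group_closure ((\<lambda>i. exponent_diff (?h i)) ` ?J)"
      using a span by (rule vanishing_lattice_generated)
    moreover have "is_binomial (?h i) \<and> homogeneous (?h i) \<and> ?h i \<in> toric_ideal" for i
      using a[of i] lattice_binomial_degree[of "a i"]
        mem_lattice_iff[OF lattice_subgroup_vanishing_lattice, of "a i", where ?'k = 'k]
      by (auto simp: is_binomial_def intro: homogeneous_binomial)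
    ultimately show "\<exists>h. (\<forall>i\<in>?J. is_binomial (h i) \<and> homogeneous (h i) \<and> h i \<in> toric_ideal) \<and>
        vanishing_lattice = group_closure ((\<lambda>i. exponent_diff (h i)) ` ?J) \<and>
        (\<forall>j. zero_set (ideal.span (h ` ?J \<union> {indet j})) = {0}) \<and>
        (\<forall>i\<in>?J. \<exists>a. h i = lattice_binomial a)"
      by (intro exI[of _ ?h]) blast
  next
    assume "\<exists>h. (\<forall>i\<in>?J. is_binomial (h i) \<and> homogeneous (h i) \<and> h i \<in> toric_ideal) \<and>
        vanishing_lattice = group_closure ((\<lambda>i. exponent_diff (h i)) ` ?J) \<and>
        (\<forall>j. zero_set (ideal.span (h ` ?J \<union> {indet j})) = {0}) \<and>
        (\<forall>i\<in>?J. \<exists>a. h i = lattice_binomial a)"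
    then obtain h where h: "\<And>i. i \<in> ?J \<Longrightarrow> h i \<in> toric_ideal"
      and lattice: "vanishing_lattice = group_closure ((\<lambda>i. exponent_diff (h i)) ` ?J)"
      and zero: "\<And>j. zero_set (ideal.span (h ` ?J \<union> {indet j})) = {0}"
      and binomial: "\<forall>i\<in>?J. \<exists>a. h i = lattice_binomial a"
      by blast
    obtain a where a: "\<And>i. i \<in> ?J \<Longrightarrow> h i = lattice_binomial (a i)"
      using bchoice[OF binomial] by blast
    have images: "h ` ?J = (\<lambda>i. lattice_binomial (a i)) ` ?J"
      "(\<lambda>i. exponent_diff (h i)) ` ?J = (\<lambda>i. exponent_diff (lattice_binomial (a i))) ` ?J"
      by (rule image_cong[OF refl], simp add: a)+
    have a_mem: "a i \<in> vanishing_lattice" if "i \<in> ?J" for i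
      using h[OF that] a[OF that] mem_lattice_iff[OF lattice_subgroup_vanishing_lattice, where ?'k = 'k]
      by simp
    have "toric_ideal = ideal.span ((\<lambda>i. lattice_binomial (a i)) ` ?J)"
      using a_mem lattice zero unfolding images by (intro toric_ideal_generated) auto
    then have "toric_ideal = ideal.span (set (map h [1..<CARD('s)]))"
      unfolding images(1)[symmetric] by (simp add: atLeastLessThanSuc_atLeastAtMost[symmetric])
    moreover have "enat (length (map h [1..<CARD('s)])) = ideal_height toric_ideal"
      by (simp add: toric_ideal_height)
    ultimately show "complete_intersection toric_ideal"
      unfolding complete_intersection_def by blast
  qed
qed

end
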